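(* If the linear differential equation of order $n-\mu-1$ $$L_{n-\mu-1}u(t)\equiv u^{(n-\mu-1)}(t)+p_1(t)u^{(n-\mu-2)}(t)+\dots+p_{n-\mu-1}(t)u(t)=0,$$ with $p_j\in C^{n-j}(I)$, is disconjugate on $I$, then the operator $$\tilde T_n[0]u(t)=u^{(n)}(t)+p_1(t)u^{(n-1)}(t)+\dots+p_{n-\mu-1}(t)u^{(\mu+1)}(t)$$ satisfies property $(T_d)$ in $X_S^E$.
   Context: Let $n\ge 2$, $k\in\{1,\dots,n-1\}$, and $I=[a,b]$ with $a<b$. Let $S=\{\sigma_1<\dots<\sigma_k\}\subset\{0,\dots,n-1\}$ and $E=\{\varepsilon_1<\dots<\varepsilon_{n-k}\}\subset\{0,\dots,n-1\}$. Put $X_S^E=\{u\in C^n(I):u^{(i)}(a)=0\ \forall i\in S,\ u^{(i)}(b)=0\ \forall i\in E\}$. Let $\alpha_2\in\{-1,0,\dots,n-2\}$ be such that $\alpha_2\notin S$ and $\{\alpha_2+1,\dots,\sigma_k\}\subset S$ (i.e. the largest integer $\ge -1$ that is less than $\sigma_k$ and not in $S$), and let $\beta_2\in\{-1,0,\dots,n-2\}$ be such that $\beta_2\notin E$ and $\{\beta_2+1,\dots,\varepsilon_{n-k}\}\subset E$ (likewise, less than $\varepsilon_{n-k}$). Let $\mu=\max\{\alpha_2,\beta_2\}$. A linear differential equation of order $m$ is disconjugate on $I$ if every nontrivial solution has fewer than $m$ zeros on $I$, counted with multiplicity. An $n$-th order linear differential operator $T$ satisfies property $(T_d)$ in $X_S^E$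 if there are functions $v_1,\dots,v_n\in C^n(I)$, positive on $I$, such that, with $T_0u=u$ and $T_\ell u=\frac{d}{dt}\left(\frac{T_{\ell-1}u}{v_\ell}\right)$ for $\ell=1,\dots,n$, one has $Tu=v_1\cdots v_n\,T_nu$ on $I$, and for every $u\in X_S^E$: $T_{\sigma}u(a)=0$ for all $\sigma\in S$ and $T_{\varepsilon}u(b)=0$ for all $\varepsilon\in E$. *)

theory Defs
  imports "HOL-Analysis.Analysis"
begin

text \<open>Functions on \<open>I = [a,b]\<close> are total functions \<open>real \<Rightarrow> real\<close> of which only the values on
  \<open>{a..b}\<close> matter.  Derivatives are taken within \<open>{a..b}\<close>, hence are one-sided at the endpoints;
  for \<open>a < b\<close> they are unique wherever they exist.\<close>

definition ideriv :: "real \<Rightarrow> real \<Rightarrow> (real \<Rightarrow> real) \<Rightarrow> real \<Rightarrow> real" where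
  "ideriv a b f = (\<lambda>t. vector_derivative f (at t within {a..b}))"

definition nderiv :: "real \<Rightarrow> real \<Rightarrow> nat \<Rightarrow> (real \<Rightarrow> real) \<Rightarrow> real \<Rightarrow> real" where
  "nderiv a b i f = (ideriv a b ^^ i) f"

definition Ck :: "real \<Rightarrow> real \<Rightarrow> nat \<Rightarrow> (real \<Rightarrow> real) set" where
  "Ck a b k = {f. (\<forall>i<k. nderiv a b i f differentiable_on {a..b}) \<and>
                  continuous_on {a..b} (nderiv a b k f)}"

text \<open>The operator \<open>u\<^sup>(\<^sup>N\<^sup>) + p\<^sub>1 u\<^sup>(\<^sup>N\<^sup>-\<^sup>1\<^sup>) + \<dots> + p\<^sub>m u\<^sup>(\<^sup>N\<^sup>-\<^sup>m\<^sup>)\<close> for \<open>m \<le> N\<close>.\<close>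

definition lin_diff_op ::
    "real \<Rightarrow> real \<Rightarrow> nat \<Rightarrow> nat \<Rightarrow> (nat \<Rightarrow> real \<Rightarrow> real) \<Rightarrow> (real \<Rightarrow> real) \<Rightarrow> real \<Rightarrow> real" where
  "lin_diff_op a b N m p u t =
     nderiv a b N u t + (\<Sum>j=1..m. p j t * nderiv a b (N - j) u t)"

text \<open>Multiplicity of \<open>t\<close> as a zero of \<open>u\<close>, counted up to \<open>m\<close> and equal to \<open>0\<close> if \<open>u t \<noteq> 0\<close>.
  The cap keeps to derivatives that a solution of an equation of order \<open>m\<close> has, and is harmless in
  disconjugacy: a zero of multiplicity at least \<open>m\<close> already violates ``fewer than \<open>m\<close> zeros''.\<close>

definition zero_mult :: "real \<Rightarrow> real \<Rightarrow> nat \<Rightarrow> (real \<Rightarrow> real) \<Rightarrow> real \<Rightarrow> nat" where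
  "zero_mult a b m u t = Max {r. r \<le> m \<and> (\<forall>i<r. nderiv a b i u t = 0)}"

definition disconjugate ::
    "real \<Rightarrow> real \<Rightarrow> nat \<Rightarrow> ((real \<Rightarrow> real) \<Rightarrow> real \<Rightarrow> real) \<Rightarrow> bool" where
  "disconjugate a b m L \<longleftrightarrow>
     (\<forall>u \<in> Ck a b m. (\<forall>t\<in>{a..b}. L u t = 0) \<and> (\<exists>t\<in>{a..b}. u t \<noteq> 0) \<longrightarrow>
        finite {t\<in>{a..b}. u t = 0} \<and>
        (\<Sum>t | t \<in> {a..b} \<and> u t = 0. zero_mult a b m u t) < m)"

definition bvp_space :: "real \<Rightarrow> real \<Rightarrow> nat \<Rightarrow> nat set \<Rightarrow> nat set \<Rightarrow> (real \<Rightarrow> real) set" where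
  "bvp_space a b n S E =
     {u \<in> Ck a b n. (\<forall>i\<in>S. nderiv a b i u a = 0) \<and> (\<forall>i\<in>E. nderiv a b i u b = 0)}"

primrec Tseq ::
    "real \<Rightarrow> real \<Rightarrow> (nat \<Rightarrow> real \<Rightarrow> real) \<Rightarrow> nat \<Rightarrow> (real \<Rightarrow> real) \<Rightarrow> real \<Rightarrow> real" where
  "Tseq a b v 0 u = u"
| "Tseq a b v (Suc l) u = ideriv a b (\<lambda>t. Tseq a b v l u t / v (Suc l) t)"

definition property_Td ::
    "real \<Rightarrow> real \<Rightarrow> nat \<Rightarrow> nat set \<Rightarrow> nat set \<Rightarrow> ((real \<Rightarrow> real) \<Rightarrow> real \<Rightarrow> real) \<Rightarrow> bool" where
  "property_Td a b n S E T \<longleftrightarrow>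
     (\<exists>v. (\<forall>l\<in>{1..n}. v l \<in> Ck a b n \<and> (\<forall>t\<in>{a..b}. v l t > 0)) \<and>
          (\<forall>u\<in>Ck a b n. \<forall>t\<in>{a..b}. T u t = (\<Prod>l=1..n. v l t) * Tseq a b v n u t) \<and>
          (\<forall>u\<in>bvp_space a b n S E.
              (\<forall>\<sigma>\<in>S. Tseq a b v \<sigma> u a = 0) \<and> (\<forall>\<epsilon>\<in>E. Tseq a b v \<epsilon> u b = 0)))"

text \<open>\<open>last_gap S \<alpha>\<close>: \<open>\<alpha>\<close> is the largest integer \<open>\<ge> -1\<close> that is less than \<open>max S\<close> and not in \<open>S\<close>.
  The condition \<open>\<alpha> < max S\<close> is needed: for \<open>\<alpha> \<ge> max S\<close> the interval below would be empty.\<close>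

definition last_gap :: "nat set \<Rightarrow> int \<Rightarrow> bool" where
  "last_gap S \<alpha> \<longleftrightarrow> -1 \<le> \<alpha> \<and> \<alpha> < int (Max S) \<and> \<alpha> \<notin> int ` S \<and> {\<alpha> + 1..int (Max S)} \<subseteq> int ` S"

end

theory Submission
  imports Defs
begin

text \<open>
  Put \<open>s = n - m = \<mu> + 1\<close>. The operator in question is \<open>u \<mapsto> L (u\<^sup>(\<^sup>s\<^sup>))\<close>, where \<open>L\<close> is the disconjugate
  operator of order \<open>m\<close>. By Polya's theorem \<open>L g = w\<^sub>1 \<dots> w\<^sub>m T\<^sub>m g\<close> with positive \<open>w\<^sub>l\<close>, and
  \<open>v = (1, \<dots>, 1, w\<^sub>1, \<dots>, w\<^sub>m)\<close> with \<open>s\<close> ones factors the operator of order \<open>n\<close>. For this \<open>v\<close>,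
  \<open>T\<^sub>l u = u\<^sup>(\<^sup>l\<^sup>)\<close> if \<open>l \<le> s\<close>, and \<open>T\<^sub>l u\<close> vanishes at a point where \<open>u\<^sup>(\<^sup>s\<^sup>), \<dots>, u\<^sup>(\<^sup>l\<^sup>)\<close> all vanish if \<open>l > s\<close>
  (lemma \<open>Tseq_zero\<close>). Since \<open>\<mu>\<close> is at least both last gaps, \<open>S\<close> contains with any \<open>\<sigma> \<ge> s\<close> the
  whole of \<open>{s..\<sigma>}\<close>, and so does \<open>E\<close>; hence the boundary conditions carry over.

  It remains to prove Polya's theorem on a compact interval, with \<open>w\<^sub>l\<close> of class \<open>C\<^sup>n\<close>. The input is
  a flag of solutions \<open>y\<^sub>0, \<dots>, y\<^sub>m\<^sub>-\<^sub>1\<close>: for every \<open>l\<close>, no nontrivial combination of the first \<open>l\<close> of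
  them has an \<open>l\<close>-fold zero in \<open>[a,b]\<close>; in other words, their Wronskian has no zero there.

  \<^item> From a flag to a factorization (lemma \<open>factorization_of_flag\<close>). The function \<open>v = \<plusminus>y\<^sub>0\<close> is
    positive, and \<open>L\<close> is a composition \<open>M (D - r)\<close> with \<open>r = v'/v\<close>. The functions \<open>(D - r) y\<^sub>e\<^sub>+\<^sub>1\<close> form
    a flag for \<open>M\<close>, so induction on the order applies. The formulas for \<open>w\<^sub>l\<close> as quotients of
    Wronskians suggest a loss of derivatives. There is none: if the coefficient of \<open>D\<^sup>h\<close>
    in \<open>L\<close> is of class \<open>C\<^sup>s\<^sup>+\<^sup>h\<close> for each \<open>h \<le> m\<close>, then that of \<open>D\<^sup>h\<close> in \<open>M\<close> is of class
    \<open>C\<^sup>s\<^sup>+\<^sup>1\<^sup>+\<^sup>h\<close> (lemma \<open>right_division\<close>). So the sum of smoothness index and order stays \<open>n\<close>, and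
    solutions of every operator that occurs are of class \<open>C\<^sup>n\<close> (lemma \<open>solution_smooth\<close>).

  \<^item> From disconjugacy to a flag (lemma \<open>disconjugate_imp_flag\<close>). Nontrivial solutions with an
    \<open>(m - l)\<close>-fold zero at \<open>a\<close> have no \<open>l\<close>-fold zero in \<open>(a,b]\<close>, but if \<open>l < m\<close> they vanish at \<open>a\<close>. Therefore their zero is
    moved a little to the left of \<open>a\<close>: one takes the solutions whose Taylor polynomial at \<open>a\<close> is
    divisible by \<open>(x + \<epsilon>)\<^sup>m\<^sup>-\<^sup>l\<close>, with \<open>x\<close> measured from \<open>a\<close>. If for arbitrarily small \<open>\<epsilon>\<close> such a nontrivial solution had an \<open>l\<close>-fold zero \<open>t\<close>
    in \<open>[a,b]\<close>, then a limit of these solutions, suitably scaled, would be nontrivial and have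
    \<open>m - l\<close> zeros at \<open>a\<close> and \<open>l\<close> zeros at a limit point of the \<open>t\<close>, or, if that point is \<open>a\<close> itself, an
    \<open>m\<close>-fold zero at \<open>a\<close> by Rolle's theorem (lemma \<open>perturbed_zero_at_left_end\<close>). The former
    contradicts disconjugacy, the latter nontriviality.
\<close>

section \<open>Functions of class \<open>C\<^sup>k\<close> on a compact interval\<close>

locale proper_interval =
  fixes a b :: real
  assumes ab: "a < b"
begin

abbreviation I :: "real set" where "I \<equiv> {a..b}"
abbreviation d1 :: "(real \<Rightarrow> real) \<Rightarrow> real \<Rightarrow> real" where "d1 \<equiv> ideriv a b"
abbreviation dn :: "nat \<Rightarrow> (real \<Rightarrow> real) \<Rightarrow> real \<Rightarrow> real" where "dn \<equiv> nderiv a b"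
abbreviation C :: "nat \<Rightarrow> (real \<Rightarrow> real) set" where "C \<equiv> Ck a b"

lemma d1_eqI:
  assumes "(f has_real_derivative D) (at t within I)" "t \<in> I"
  shows "d1 f t = D"
  using vector_derivative_within_cbox[OF ab, of t f D] assms
  by (simp add: ideriv_def has_real_derivative_iff_has_vector_derivative)

lemma has_d1:
  assumes "f differentiable_on I" "t \<in> I"
  shows "(f has_real_derivative d1 f t) (at t within I)"
proof -
  have "f differentiable (at t within I)"
    using assms by (simp add: differentiable_on_def)
  then show ?thesis
    by (simp add: ideriv_def has_real_derivative_iff_has_vector_derivative vector_derivative_works)
qed

lemma differentiable_on_if_has_derivative:
  assumes "\<And>t. t \<in> I \<Longrightarrow> (f has_real_derivative D t) (at t within I)"
  shows "f differentiable_on I"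
  using assms unfolding real_differentiable_def differentiable_on_def by blast

lemma d1_cong:
  assumes "\<And>t. t \<in> I \<Longrightarrow> f t = g t" "t \<in> I"
  shows "d1 f t = d1 g t"
proof -
  have "(f has_vector_derivative D) (at t within I) \<longleftrightarrow> (g has_vector_derivative D) (at t within I)" for D
    using has_vector_derivative_transform[of t I g f D] has_vector_derivative_transform[of t I f g D] assms
    by auto
  then show ?thesis unfolding ideriv_def vector_derivative_def by presburger
qed

lemma dn_0 [simp]: "dn 0 f = f"
  by (simp add: nderiv_def)

lemma dn_Suc: "dn (Suc i) f = d1 (dn i f)"
  by (simp add: nderiv_def)

lemma dn_Suc_right: "dn (Suc i) f = dn i (d1 f)"
  by (simp add: nderiv_def funpow_swap1)

lemma dn_dn: "dn i (dn j f) = dn (i + j) f"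
  by (simp add: nderiv_def funpow_add)

lemma dn_cong:
  assumes "\<And>t. t \<in> I \<Longrightarrow> f t = g t" "t \<in> I"
  shows "dn i f t = dn i g t"
  using assms(2)
proof (induction i arbitrary: t)
  case (Suc i)
  show ?case unfolding dn_Suc by (rule d1_cong[OF Suc.IH Suc.prems])
qed (simp add: assms(1))

lemma differentiable_on_cong:
  assumes "\<And>t. t \<in> I \<Longrightarrow> f t = g t" "f differentiable_on I"
  shows "g differentiable_on I"
  unfolding differentiable_on_def
proof
  fix t assume t: "t \<in> I"
  then have "f differentiable (at t within I)" using assms(2) by (simp add: differentiable_on_def)
  then show "g differentiable (at t within I)"
    by (rule differentiable_transform_within[where d = 1]) (use t assms(1) in auto)
qed

lemma C_0: "f \<in> C 0 \<longleftrightarrow> continuous_on I f"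
  by (simp add: Ck_def)

lemma C_Suc: "f \<in> C (Suc k) \<longleftrightarrow> f differentiable_on I \<and> d1 f \<in> C k"
proof -
  have "(\<forall>i<Suc k. dn i f differentiable_on I) \<longleftrightarrow>
        f differentiable_on I \<and> (\<forall>i<k. dn i (d1 f) differentiable_on I)"
    by (simp only: All_less_Suc2 dn_Suc_right dn_0)
  then show ?thesis by (simp only: Ck_def dn_Suc_right mem_Collect_eq conj_assoc)
qed

lemma C_continuous_on:
  assumes "f \<in> C k" shows "continuous_on I f"
  using assms by (cases k) (auto simp: C_0 C_Suc differentiable_imp_continuous_on)

lemma C_decr: "f \<in> C (Suc k) \<Longrightarrow> f \<in> C k"
proof (induction k arbitrary: f)
  case 0
  then show ?case using C_continuous_on C_0 by blast
next
  case (Suc k)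
  then show ?case using C_Suc by metis
qed

lemma C_mono: "f \<in> C k \<Longrightarrow> j \<le> k \<Longrightarrow> f \<in> C j"
  by (induction k) (auto simp: le_Suc_eq dest: C_decr)

lemma C_cong:
  assumes "f \<in> C k" "\<And>t. t \<in> I \<Longrightarrow> f t = g t"
  shows "g \<in> C k"
  using assms
proof (induction k arbitrary: f g)
  case 0
  then show ?case using continuous_on_cong[of I I f g] by (simp add: C_0)
next
  case (Suc k)
  then have "d1 f \<in> C k" "f differentiable_on I" by (auto simp: C_Suc)
  moreover have "d1 f t = d1 g t" if "t \<in> I" for t
    using d1_cong Suc.prems(2) that by blast
  ultimately show ?case
    using Suc.IH[of "d1 f" "d1 g"] differentiable_on_cong[of f g] Suc.prems(2) by (auto simp: C_Suc)
qed

lemma C_dn: "f \<in> C (i + k) \<Longrightarrow> dn i f \<in> C k"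
  by (induction i arbitrary: f) (auto simp: C_Suc dn_Suc_right)

lemma C_of_dn: "f \<in> C i \<Longrightarrow> dn i f \<in> C k \<Longrightarrow> f \<in> C (i + k)"
  by (induction i arbitrary: f) (simp_all add: C_Suc dn_Suc_right)

lemma C_dn_le: "f \<in> C k \<Longrightarrow> i + j \<le> k \<Longrightarrow> dn i f \<in> C j"
  by (rule C_dn) (rule C_mono)

lemma C_has_derivative:
  assumes "f \<in> C k" "i < k" "t \<in> I"
  shows "(dn i f has_real_derivative dn (Suc i) f t) (at t within I)"
  using assms has_d1[of "dn i f" t] by (simp add: Ck_def dn_Suc)

lemma C_has_derivative1:
  assumes "f \<in> C (Suc k)" "t \<in> I"
  shows "(f has_real_derivative d1 f t) (at t within I)"
  using assms C_Suc has_d1 by blast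

lemma C_SucI:
  assumes "\<And>t. t \<in> I \<Longrightarrow> (f has_real_derivative g t) (at t within I)" "g \<in> C k"
  shows "f \<in> C (Suc k)"
proof -
  have "d1 f t = g t" if "t \<in> I" for t using assms(1) d1_eqI that by blast
  then show ?thesis
    using C_cong[of g k "d1 f"] assms differentiable_on_if_has_derivative by (auto simp: C_Suc)
qed

lemma C_const: "(\<lambda>t. c) \<in> C k"
proof (induction k arbitrary: c)
  case 0
  then show ?case by (simp add: C_0)
next
  case (Suc k)
  show ?case by (rule C_SucI[OF _ Suc[of 0]]) (auto intro!: derivative_eq_intros)
qed

lemma C_add:
  assumes "f \<in> C k" "g \<in> C k"
  shows "(\<lambda>t. f t + g t) \<in> C k"
  using assms
proof (induction k arbitrary: f g)
  case 0
  then show ?case by (auto simp: C_0 intro: continuous_intros)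
next
  case (Suc k)
  show ?case
    by (rule C_SucI[OF _ Suc.IH[of "d1 f" "d1 g"]])
      (use Suc.prems in \<open>auto intro!: derivative_eq_intros C_has_derivative1 simp: C_Suc\<close>)
qed

lemma C_mult:
  assumes "f \<in> C k" "g \<in> C k"
  shows "(\<lambda>t. f t * g t) \<in> C k"
  using assms
proof (induction k arbitrary: f g)
  case 0
  then show ?case by (auto simp: C_0 intro: continuous_intros)
next
  case (Suc k)
  have "(\<lambda>t. d1 f t * g t + f t * d1 g t) \<in> C k"
    using Suc.prems by (intro C_add Suc.IH) (auto simp: C_Suc intro: C_decr)
  then show ?case
    by (rule C_SucI[rotated])
      (use Suc.prems in \<open>auto intro!: derivative_eq_intros C_has_derivative1\<close>)
qed

lemma C_cmult: "f \<in> C k \<Longrightarrow> (\<lambda>t. c * f t) \<in> C k"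
  by (rule C_mult[OF C_const])

lemma C_diff: "f \<in> C k \<Longrightarrow> g \<in> C k \<Longrightarrow> (\<lambda>t. f t - g t) \<in> C k"
  using C_add[OF _ C_cmult[where c = "-1"], of f k g]
  by (simp only: mult_minus1 add_uminus_conv_diff)

lemma C_sum: "(\<And>x. x \<in> X \<Longrightarrow> f x \<in> C k) \<Longrightarrow> (\<lambda>t. \<Sum>x\<in>X. f x t) \<in> C k"
  by (induction X rule: infinite_finite_induct) (simp_all add: C_const C_add)

lemma C_inverse:
  assumes "f \<in> C k" "\<And>t. t \<in> I \<Longrightarrow> f t \<noteq> 0"
  shows "(\<lambda>t. inverse (f t)) \<in> C k"
  using assms(1)
proof (induction k)
  case 0
  then show ?case using assms(2) by (auto simp: C_0 intro: continuous_intros)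
next
  case (Suc k)
  have "(\<lambda>t. (- 1) * (d1 f t * (inverse (f t) * inverse (f t)))) \<in> C k"
    using Suc.IH Suc.prems C_decr[OF Suc.prems] by (intro C_cmult C_mult) (auto simp: C_Suc)
  then show ?case
    by (rule C_SucI[rotated])
      (use Suc.prems assms(2) in \<open>auto intro!: derivative_eq_intros C_has_derivative1\<close>)
qed

lemma C_divide:
  assumes "f \<in> C k" "g \<in> C k" "\<And>t. t \<in> I \<Longrightarrow> g t \<noteq> 0"
  shows "(\<lambda>t. f t / g t) \<in> C k"
  using C_mult[OF assms(1) C_inverse[OF assms(2,3)]] by (simp add: field_simps)

lemma dn_sum_cmult:
  assumes "\<And>x. x \<in> X \<Longrightarrow> f x \<in> C k" "i \<le> k" "t \<in> I"
  shows "dn i (\<lambda>t. \<Sum>x\<in>X. c x * f x t) t = (\<Sum>x\<in>X. c x * dn i (f x) t)"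
  using assms(2,3)
proof (induction i arbitrary: t)
  case (Suc i)
  have "dn (Suc i) (\<lambda>t. \<Sum>x\<in>X. c x * f x t) t = d1 (\<lambda>t. \<Sum>x\<in>X. c x * dn i (f x) t) t"
    using Suc by (auto simp: dn_Suc intro!: d1_cong)
  also have "\<dots> = (\<Sum>x\<in>X. c x * dn (Suc i) (f x) t)"
    by (rule d1_eqI) (use Suc.prems assms(1) in
      \<open>auto intro!: derivative_eq_intros C_has_derivative[where k = k] sum.cong simp: mult.commute\<close>)
  finally show ?case .
qed simp

lemma dn_lincomb:
  assumes "f \<in> C k" "g \<in> C k" "i \<le> k" "t \<in> I"
  shows "dn i (\<lambda>t. x * f t + y * g t) t = x * dn i f t + y * dn i g t"
  using dn_sum_cmult[of "{False, True}" "\<lambda>j. if j then g else f" k i t "\<lambda>j. if j then y else x"] assms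
  by simp

lemma dn_add:
  assumes "f \<in> C k" "g \<in> C k" "i \<le> k" "t \<in> I"
  shows "dn i (\<lambda>t. f t + g t) t = dn i f t + dn i g t"
  using dn_lincomb[OF assms, where x = 1 and y = 1] by (simp only: mult_1)

lemma dn_diff:
  assumes "f \<in> C k" "g \<in> C k" "i \<le> k" "t \<in> I"
  shows "dn i (\<lambda>t. f t - g t) t = dn i f t - dn i g t"
  using dn_lincomb[OF assms, where x = 1 and y = "-1"]
  by (simp only: mult_1 mult_minus1 add_uminus_conv_diff)

lemma d1_mult:
  assumes "f \<in> C (Suc k)" "g \<in> C (Suc k)" "t \<in> I"
  shows "d1 (\<lambda>t. f t * g t) t = d1 f t * g t + f t * d1 g t"
  by (rule d1_eqI) (use assms in \<open>auto intro!: derivative_eq_intros C_has_derivative1\<close>)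

text \<open>The order of a zero does not drop under multiplication by a smooth function. Differentiating
  once leaves two products, each with a factor that has a zero of order at least \<open>r - 1\<close>.\<close>
lemma mult_zero_order:
  assumes "f \<in> C k" "g \<in> C k" "r \<le> Suc k" "t \<in> I" "\<And>i. i < r \<Longrightarrow> dn i f t = 0" "i < r"
  shows "dn i (\<lambda>t. f t * g t) t = 0"
  using assms
proof (induction i arbitrary: f g k r)
  case 0
  then show ?case using 0(5)[of 0] by simp
next
  case (Suc i)
  obtain k' where k': "k = Suc k'" using Suc.prems(3,6) by (cases k) auto
  have f1: "d1 f \<in> C k'" "d1 g \<in> C k'" "f \<in> C k'" "g \<in> C k'"
    using Suc.prems k' by (auto simp: C_Suc intro: C_decr)
  have "dn (Suc i) (\<lambda>t. f t * g t) t = dn i (\<lambda>t. d1 f t * g t + f t * d1 g t) t"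
    unfolding dn_Suc_right using Suc.prems k' by (intro dn_cong) (auto intro!: d1_mult)
  also have "\<dots> = dn i (\<lambda>t. d1 f t * g t) t + dn i (\<lambda>t. f t * d1 g t) t"
    by (rule dn_add[of _ k']) (use f1 Suc.prems k' in \<open>auto intro!: C_mult\<close>)
  also have "dn i (\<lambda>t. d1 f t * g t) t = 0"
  proof (rule Suc.IH[of _ k' _ "r - 1"])
    fix j assume "j < r - 1"
    then show "dn j (d1 f) t = 0" using Suc.prems(5)[of "Suc j"] by (simp add: dn_Suc_right)
  qed (use Suc.prems k' f1 in auto)
  also have "dn i (\<lambda>t. f t * d1 g t) t = 0"
    by (rule Suc.IH[of _ k' _ "r - 1"]) (use Suc.prems k' f1 in auto)
  finally show ?case by simp
qed

lemma Tseq_cong: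
  assumes "\<And>t. t \<in> I \<Longrightarrow> f t = g t" "t \<in> I"
  shows "Tseq a b v l f t = Tseq a b v l g t"
  using assms(2)
  by (induction l arbitrary: t) (auto simp: assms(1) intro!: d1_cong)

end

section \<open>Division by a first-order operator, and smoothness of solutions\<close>

context proper_interval begin

text \<open>The Leibniz rule in the form needed below: only the smoothness of the coefficients of the operator
  \<open>u \<mapsto> D\<^sup>m (r u)\<close> matters. Coefficients of higher derivatives of \<open>u\<close> contain fewer
  derivatives of \<open>r\<close>, so their smoothness grows with \<open>h\<close>.\<close>
lemma Leibniz_expansion:
  assumes "r \<in> C (s + m)"
  shows "\<exists>c. (\<forall>h\<le>m. c h \<in> C (s + h)) \<and>
    (\<forall>u\<in>C m. \<forall>t\<in>I. dn m (\<lambda>t. r t * u t) t = (\<Sum>h\<le>m. c h t * dn h u t))"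
  using assms
proof (induction m arbitrary: s)
  case 0
  then show ?case by (intro exI[of _ "\<lambda>h. r"]) auto
next
  case (Suc m)
  then obtain c where c: "\<And>h. h \<le> m \<Longrightarrow> c h \<in> C (Suc (s + h))"
    "\<And>u t. u \<in> C m \<Longrightarrow> t \<in> I \<Longrightarrow> dn m (\<lambda>t. r t * u t) t = (\<Sum>h\<le>m. c h t * dn h u t)"
    using Suc.IH[of "Suc s"] by (metis add_Suc add_Suc_right)
  define e where "e h = (\<lambda>t. (if h \<le> m then d1 (c h) t else 0) + (if h = 0 then 0 else c (h - 1) t))" for h
  have e: "e h \<in> C (s + h)" if "h \<le> Suc m" for h
  proof -
    have "(\<lambda>t. if h \<le> m then d1 (c h) t else 0) \<in> C (s + h)"
      using c(1)[of h] by (cases "h \<le> m") (auto simp: C_Suc C_const)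
    moreover have "(\<lambda>t. if h = 0 then 0 else c (h - 1) t) \<in> C (s + h)"
      using c(1)[of "h - 1"] that by (cases h) (auto simp: C_const)
    ultimately show ?thesis unfolding e_def by (rule C_add)
  qed
  have "dn (Suc m) (\<lambda>t. r t * u t) t = (\<Sum>h\<le>Suc m. e h t * dn h u t)"
    if u: "u \<in> C (Suc m)" and t: "t \<in> I" for u t
  proof -
    have "dn (Suc m) (\<lambda>t. r t * u t) t = d1 (\<lambda>t. \<Sum>h\<le>m. c h t * dn h u t) t"
      unfolding dn_Suc using c(2) u C_decr t by (intro d1_cong) auto
    also have "\<dots> = (\<Sum>h\<le>m. d1 (c h) t * dn h u t + c h t * dn (Suc h) u t)"
      by (rule d1_eqI) (use c(1) u t in
        \<open>auto intro!: derivative_eq_intros C_has_derivative[where k = "Suc m"] C_has_derivative1 sum.cong\<close>)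
    also have "\<dots> = (\<Sum>h\<le>m. d1 (c h) t * dn h u t) + (\<Sum>h\<le>m. c h t * dn (Suc h) u t)"
      by (rule sum.distrib)
    also have "(\<Sum>h\<le>m. d1 (c h) t * dn h u t)
        = (\<Sum>h\<le>Suc m. (if h \<le> m then d1 (c h) t else 0) * dn h u t)"
      by (simp add: sum.atMost_Suc)
    also have "(\<Sum>h\<le>m. c h t * dn (Suc h) u t)
        = (\<Sum>h\<le>Suc m. (if h = 0 then 0 else c (h - 1) t) * dn h u t)"
      by (simp add: sum.atMost_Suc_shift del: sum.atMost_Suc)
    finally show ?thesis by (simp only: e_def sum.distrib distrib_right)
  qed
  then show ?case using e by blast
qed

text \<open>Euclidean division of \<open>\<Sum>\<^sub>h k\<^sub>h D\<^sup>h\<close> by \<open>D - r\<close> on the right; the remainder \<open>R\<close> is of order zero. As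
  \<open>D\<^sup>m\<^sup>+\<^sup>1 u = D\<^sup>m (u' - r u) + D\<^sup>m (r u)\<close>, the leading term reduces to an operator of order \<open>m\<close>, and its
  coefficients are as smooth as those of the dividend. The quotient has one more derivative than the
  dividend at the same \<open>D\<^sup>h\<close>, because its coefficients come from those one order higher.\<close>
lemma right_division:
  assumes "\<And>h. h \<le> m \<Longrightarrow> k h \<in> C (s + h)" "r \<in> C N" "s + m \<le> Suc N"
  shows "\<exists>q R. (\<forall>h<m. q h \<in> C (Suc (s + h))) \<and> (\<forall>j. m = Suc j \<longrightarrow> q j = k m) \<and>
    (\<forall>u\<in>C m. \<forall>t\<in>I. (\<Sum>h\<le>m. k h t * dn h u t) =
       (\<Sum>h<m. q h t * dn h (\<lambda>t. d1 u t - r t * u t) t) + R t * u t)"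
  using assms
proof (induction m arbitrary: k)
  case 0
  then show ?case by (intro exI[of _ k] exI[of _ "k 0"]) auto
next
  case (Suc m)
  have r: "r \<in> C (s + m)" using Suc.prems(2,3) C_mono by simp
  obtain c where c: "\<And>h. h \<le> m \<Longrightarrow> c h \<in> C (s + h)"
    "\<And>u t. u \<in> C m \<Longrightarrow> t \<in> I \<Longrightarrow> dn m (\<lambda>t. r t * u t) t = (\<Sum>h\<le>m. c h t * dn h u t)"
    using Leibniz_expansion[OF r] by metis
  define k' where "k' h = (\<lambda>t. k h t + k (Suc m) t * c h t)" for h
  have "k' h \<in> C (s + h)" if "h \<le> m" for h
    unfolding k'_def using Suc.prems(1)[of h] C_mono[OF Suc.prems(1)[of "Suc m"], of "s + h"] c(1)[of h] that
    by (intro C_add C_mult) auto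
  then obtain q R where q: "\<And>h. h < m \<Longrightarrow> q h \<in> C (Suc (s + h))"
    "\<And>u t. u \<in> C m \<Longrightarrow> t \<in> I \<Longrightarrow> (\<Sum>h\<le>m. k' h t * dn h u t) =
       (\<Sum>h<m. q h t * dn h (\<lambda>t. d1 u t - r t * u t) t) + R t * u t"
    using Suc.IH[of k'] Suc.prems by fastforce
  define q' where "q' = q(m := k (Suc m))"
  have "q' h \<in> C (Suc (s + h))" if "h < Suc m" for h
    using that q(1)[of h] Suc.prems(1)[of "Suc m"] by (auto simp: q'_def less_Suc_eq)
  moreover have "(\<Sum>h\<le>Suc m. k h t * dn h u t) =
       (\<Sum>h<Suc m. q' h t * dn h (\<lambda>t. d1 u t - r t * u t) t) + R t * u t"
    if u: "u \<in> C (Suc m)" and t: "t \<in> I" for u t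
  proof -
    have um: "u \<in> C m" using u C_decr by blast
    have "dn m (\<lambda>t. d1 u t - r t * u t) t = dn m (d1 u) t - dn m (\<lambda>t. r t * u t) t"
      by (rule dn_diff[of _ m]) (use u um t C_mono[OF r] in \<open>auto simp: C_Suc intro!: C_mult\<close>)
    also have "\<dots> = dn (Suc m) u t - (\<Sum>h\<le>m. c h t * dn h u t)"
      using c(2)[OF um t] by (simp add: dn_Suc_right)
    finally have top: "k (Suc m) t * dn (Suc m) u t = k (Suc m) t * dn m (\<lambda>t. d1 u t - r t * u t) t
        + (\<Sum>h\<le>m. k (Suc m) t * c h t * dn h u t)"
      by (simp add: sum_distrib_left right_diff_distrib mult.assoc)
    have "(\<Sum>h\<le>Suc m. k h t * dn h u t)
        = k (Suc m) t * dn m (\<lambda>t. d1 u t - r t * u t) t + (\<Sum>h\<le>m. k' h t * dn h u t)"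
      unfolding k'_def by (simp add: top sum.distrib distrib_right)
    then show ?thesis using q(2)[OF um t] by (simp add: q'_def)
  qed
  ultimately show ?case by (intro exI[of _ q'] exI[of _ R]) (auto simp: q'_def)
qed

text \<open>Bootstrapping: the equation expresses \<open>u\<^sup>(\<^sup>m\<^sup>)\<close> by lower derivatives, so each derivative gained for \<open>u\<close>
  gives another one, until the smoothness of the coefficients is exhausted.\<close>
lemma solution_smooth:
  assumes "\<And>h. h < m \<Longrightarrow> k h \<in> C s" "u \<in> C m"
    and "\<And>t. t \<in> I \<Longrightarrow> dn m u t = - (\<Sum>h<m. k h t * dn h u t)"
  shows "u \<in> C (m + s)"
proof -
  have "i \<le> s \<Longrightarrow> u \<in> C (m + i)" for i
  proof (induction i)
    case (Suc i)
    have "(\<lambda>t. (- 1) * (\<Sum>h<m. k h t * dn h u t)) \<in> C (Suc i)"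
      using Suc assms(1) by (intro C_cmult C_sum C_mult) (auto intro: C_mono C_dn_le)
    then have "dn m u \<in> C (Suc i)" by (rule C_cong) (simp add: assms(3))
    then show ?case using C_of_dn assms(2) by blast
  qed (simp add: assms(2))
  then show ?thesis by blast
qed

end

section \<open>Factorization along a flag of solutions\<close>

context proper_interval begin

text \<open>The second condition says that the Wronskian of \<open>y\<^sub>0, \<dots>, y\<^sub>l\<^sub>-\<^sub>1\<close> has no zero on the interval, for each
  \<open>l \<le> m\<close>. Stated with linear combinations it passes to the reduced functions without determinants.\<close>
definition flag :: "nat \<Rightarrow> (nat \<Rightarrow> real \<Rightarrow> real) \<Rightarrow> bool" where
  "flag m y \<longleftrightarrow> (\<forall>e<m. y e \<in> C m) \<and>
     (\<forall>l\<le>m. \<forall>c. \<forall>t\<in>I. (\<forall>i<l. (\<Sum>e<l. c e * dn i (y e) t) = 0) \<longrightarrow> (\<forall>e<l. c e = 0))"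

text \<open>Reduction of order in terms of zeros: as \<open>Y' - (v'/v) Y = v (Y/v)'\<close>, an \<open>l\<close>-fold zero of the left
  side at \<open>t\<close> makes \<open>Y/v - Y(t)/v(t)\<close> vanish to order \<open>l + 1\<close> there.\<close>
lemma quotient_zero_order:
  assumes Y: "Y \<in> C (Suc m)" and v: "v \<in> C (Suc m)" "\<And>t. t \<in> I \<Longrightarrow> v t > 0"
    and l: "l \<le> m" "t \<in> I" and z: "\<And>i. i < l \<Longrightarrow> dn i (\<lambda>t. d1 Y t - d1 v t / v t * Y t) t = 0"
    and i: "i < Suc l"
  shows "dn i (\<lambda>s. Y s - Y t / v t * v s) t = 0"
proof -
  define z where "z = (\<lambda>t. d1 Y t - d1 v t / v t * Y t)"
  define G where "G = (\<lambda>s. Y s / v s - Y t / v t)"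
  have v0: "v s \<noteq> 0" if "s \<in> I" for s using v(2)[OF that] by simp
  have zC: "z \<in> C m"
    unfolding z_def using Y v by (intro C_diff C_mult C_divide) (auto simp: C_Suc v0 intro: C_decr)
  have GC: "G \<in> C (Suc m)"
    unfolding G_def using Y v v0 by (intro C_diff C_const C_divide) auto
  have d1G: "d1 G s = z s * inverse (v s)" if s: "s \<in> I" for s
  proof -
    have "d1 G s = (d1 Y s * v s - Y s * d1 v s) / (v s * v s)"
      unfolding G_def
      by (rule d1_eqI[OF _ s])
        (use Y v(1) v0[OF s] s in \<open>auto intro!: derivative_eq_intros C_has_derivative1\<close>)
    also have "\<dots> = z s * inverse (v s)"
      using v0[OF s] by (simp add: z_def field_simps)
    finally show ?thesis .
  qed
  have G: "dn j G t = 0" if "j < Suc l" for j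
  proof (cases j)
    case 0
    then show ?thesis by (simp add: G_def)
  next
    case (Suc j')
    have "dn j G t = dn j' (\<lambda>s. z s * inverse (v s)) t"
      unfolding Suc dn_Suc_right using d1G l(2) by (rule dn_cong)
    also have "\<dots> = 0"
      by (rule mult_zero_order[where k = m and r = l])
        (use zC C_inverse[OF C_decr[OF v(1)]] v0 l z that Suc in \<open>auto simp: z_def\<close>)
    finally show ?thesis .
  qed
  have "dn i (\<lambda>s. Y s - Y t / v t * v s) t = dn i (\<lambda>s. G s * v s) t"
    by (rule dn_cong) (use v0 l in \<open>auto simp: G_def field_simps\<close>)
  also have "\<dots> = 0"
    by (rule mult_zero_order[where k = "Suc m" and r = "Suc l"]) (use GC v l G i in auto)
  finally show ?thesis .
qed

text \<open>With \<open>r = v'/v\<close> one has \<open>(D - r) u = v (u/v)'\<close>. Thus applying the sequence of \<open>w\<close> after \<open>D - r\<close> is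
  the sequence that starts with \<open>v\<close> and absorbs the remaining factor \<open>v\<close> into its second member
  \<open>w\<^sub>1/v\<close>.\<close>
lemma Tseq_merge:
  fixes w :: "nat \<Rightarrow> real \<Rightarrow> real"
  assumes pos: "\<And>t. t \<in> I \<Longrightarrow> v t > 0" and u: "u \<in> C (Suc k)" and v: "v \<in> C (Suc k)" and t: "t \<in> I"
  defines "x \<equiv> \<lambda>l. if l \<le> 1 then v else if l = 2 then (\<lambda>t. w 1 t / v t) else w (l - 1)"
  shows "(\<Prod>l=1..Suc m. x l t) * Tseq a b x (Suc m) u t =
    (\<Prod>l=1..m. w l t) * Tseq a b w m (\<lambda>t. d1 u t - d1 v t / v t * u t) t"
proof -
  have v0: "v s \<noteq> 0" if "s \<in> I" for s using pos[OF that] by simp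
  define g where "g = (\<lambda>t. v t * Tseq a b x 1 u t)"
  have g: "g s = d1 u s - d1 v s / v s * u s" if s: "s \<in> I" for s
  proof -
    have "d1 (\<lambda>t. u t / v t) s = (d1 u s * v s - u s * d1 v s) / (v s * v s)"
      by (rule d1_eqI[OF _ s])
        (use u v v0 s in \<open>auto intro!: derivative_eq_intros C_has_derivative1\<close>)
    then show ?thesis using v0[OF s] by (simp add: g_def x_def divide_simps) (simp add: algebra_simps)
  qed
  have T: "Tseq a b x (Suc (Suc l)) u = Tseq a b w (Suc l) g" for l
    by (induction l) (simp_all add: g_def x_def mult.commute)
  have P: "(\<Prod>l=1..Suc (Suc l). x l t) = (\<Prod>l=1..Suc l. w l t)" for l
    by (induction l) (use v0[OF t] in \<open>simp_all add: x_def\<close>)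
  show ?thesis
  proof (cases m)
    case 0
    then show ?thesis using g[OF t] by (simp add: g_def x_def)
  next
    case (Suc l)
    have "Tseq a b w m g t = Tseq a b w m (\<lambda>t. d1 u t - d1 v t / v t * u t) t"
      using g t by (rule Tseq_cong)
    then show ?thesis by (simp only: Suc T P)
  qed
qed

lemma positive_or_negative:
  assumes "continuous_on I f" "\<And>t. t \<in> I \<Longrightarrow> f t \<noteq> 0"
  shows "(\<forall>t\<in>I. f t > 0) \<or> (\<forall>t\<in>I. - f t > (0::real))"
proof -
  have c: "connected (f ` I)" by (rule connected_continuous_image[OF assms(1)]) simp
  have "0 \<notin> f ` I" using assms(2) by auto
  then have "\<not> (f s < 0 \<and> f t > 0)" if "s \<in> I" "t \<in> I" for s t
    using connectedD_interval[OF c, of "f s" "f t" 0] that by auto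
  then show ?thesis using assms(2) by (metis neg_0_less_iff_less linorder_neqE_linordered_idom)
qed

text \<open>Induction on the order \<open>m\<close>, where \<open>s + m\<close> stays constant: the first member \<open>\<plusminus>y\<^sub>0\<close> of the flag splits off
  the factor \<open>D - r\<close>. The remainder of the division vanishes because it annihilates the zero-free function
  \<open>y\<^sub>0\<close>.\<close>
lemma factorization_of_flag:
  assumes "\<And>h. h \<le> m \<Longrightarrow> k h \<in> C (s + h)" "\<And>t. t \<in> I \<Longrightarrow> k m t = 1"
    and "flag m y" "\<And>e t. e < m \<Longrightarrow> t \<in> I \<Longrightarrow> (\<Sum>h\<le>m. k h t * dn h (y e) t) = 0"
  shows "\<exists>w. (\<forall>l\<in>{1..m}. w l \<in> C (s + m) \<and> (\<forall>t\<in>I. w l t > 0)) \<and>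
    (\<forall>u\<in>C m. \<forall>t\<in>I. (\<Sum>h\<le>m. k h t * dn h u t) = (\<Prod>l=1..m. w l t) * Tseq a b w m u t)"
  using assms
proof (induction m arbitrary: s k y)
  case 0
  then show ?case by auto
next
  case (Suc m)
  have yC: "y e \<in> C (Suc m)" if "e < Suc m" for e
    using Suc.prems(3) that by (simp add: flag_def)
  have flag: "c e = 0" if "l \<le> Suc m" "t \<in> I" "\<And>i. i < l \<Longrightarrow> (\<Sum>e<l. c e * dn i (y e) t) = 0" "e < l" for l c t e
    using Suc.prems(3) that unfolding flag_def by blast
  have y0: "y 0 t \<noteq> 0" if "t \<in> I" for t
    using flag[of 1 t "\<lambda>_. 1" 0] that by auto
  obtain \<sigma> :: real where \<sigma>: "\<sigma> * y 0 t > 0" if "t \<in> I" for t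
    using positive_or_negative[OF C_continuous_on[OF yC] y0]
    by (metis mult_1 mult_minus1 zero_less_Suc)
  define v where "v t = \<sigma> * y 0 t" for t
  have vpos: "v t > 0" if "t \<in> I" for t using \<sigma> that by (simp add: v_def)
  have v0: "v t \<noteq> 0" if "t \<in> I" for t using vpos[OF that] by simp
  have vC': "v \<in> C (Suc m)"
    unfolding v_def using yC by (intro C_cmult) auto
  have Kv: "(\<Sum>h\<le>Suc m. k h t * dn h v t) = 0" if t: "t \<in> I" for t
  proof -
    have "dn h v t = \<sigma> * dn h (y 0) t" if "h \<le> Suc m" for h
      using dn_sum_cmult[of "{0}" y "Suc m" h t "\<lambda>_. \<sigma>"] yC that t by (simp add: v_def[abs_def])
    then have "(\<Sum>h\<le>Suc m. k h t * dn h v t) = \<sigma> * (\<Sum>h\<le>Suc m. k h t * dn h (y 0) t)"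
      unfolding sum_distrib_left by (intro sum.cong) auto
    then show ?thesis using Suc.prems(4)[of 0 t] t by simp
  qed
  have vC: "v \<in> C (Suc m + s)"
  proof (rule solution_smooth[OF _ vC'])
    show "k h \<in> C s" if "h < Suc m" for h
      using Suc.prems(1)[of h] that C_mono by auto
    show "dn (Suc m) v t = - (\<Sum>h<Suc m. k h t * dn h v t)" if "t \<in> I" for t
      using Kv[OF that] Suc.prems(2)[OF that]
      by (simp add: sum.atMost_Suc lessThan_Suc_atMost del: sum.lessThan_Suc) 
  qed
  define r where "r t = d1 v t / v t" for t
  have rC: "r \<in> C (s + m)"
    unfolding r_def using vC v0 by (intro C_divide) (auto simp: C_Suc add.commute intro: C_decr)
  obtain q R where q: "\<And>h. h < Suc m \<Longrightarrow> q h \<in> C (Suc (s + h))" "q m = k (Suc m)"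
    "\<And>u t. u \<in> C (Suc m) \<Longrightarrow> t \<in> I \<Longrightarrow> (\<Sum>h\<le>Suc m. k h t * dn h u t) =
       (\<Sum>h<Suc m. q h t * dn h (\<lambda>t. d1 u t - r t * u t) t) + R t * u t"
    using right_division[of "Suc m" k s r "s + m", OF Suc.prems(1) rC] by fastforce
  \<comment> \<open>Apply the division identity to \<open>v\<close>: both \<open>L v\<close> and \<open>v' - r v\<close> vanish.\<close>
  have R0: "R t = 0" if t: "t \<in> I" for t
  proof -
    have "dn h (\<lambda>t. d1 v t - r t * v t) t = 0" for h
    proof -
      have "dn h (\<lambda>t. d1 v t - r t * v t) t = dn h (\<lambda>t. 0 * v t) t"
        using t by (intro dn_cong) (auto simp: r_def v0)
      also have "\<dots> = 0" using dn_sum_cmult[of "{}" "\<lambda>x. v" h h t] t by simp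
      finally show ?thesis .
    qed
    then show ?thesis using q(3)[OF vC' t] Kv[OF t] v0[OF t] by simp
  qed
  define z where "z e = (\<lambda>t. d1 (y (Suc e)) t - r t * y (Suc e) t)" for e
  have rCm: "r \<in> C m" using rC C_mono by simp
  have zC: "z e \<in> C m" if "e < m" for e
    unfolding z_def using yC[of "Suc e"] that rCm
    by (intro C_diff C_mult) (auto simp: C_Suc intro: C_decr)
  have "flag m z"
    unfolding flag_def
  proof (intro conjI allI impI ballI)
    fix l c t e
    assume l: "l \<le> m" and t: "t \<in> I" and zz: "\<forall>i<l. (\<Sum>e<l. c e * dn i (z e) t) = 0" and e: "e < l"
    define Y where "Y = (\<lambda>t. \<Sum>e<l. c e * y (Suc e) t)"
    have YC: "Y \<in> C (Suc m)"
      unfolding Y_def using yC l by (intro C_sum C_cmult) auto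
    \<comment> \<open>Subtracting \<open>\<alpha> v\<close> turns the \<open>l\<close>-fold zero of \<open>(D - r) Y\<close> into an \<open>(l + 1)\<close>-fold zero in the span of \<open>y\<^sub>0, \<dots>, y\<^sub>l\<close>.\<close>
    define \<alpha> where "\<alpha> = Y t / v t"
    define c' where "c' e = (case e of 0 \<Rightarrow> - \<alpha> * \<sigma> | Suc e' \<Rightarrow> c e')" for e
    have d1Y: "d1 Y s = (\<Sum>e<l. c e * d1 (y (Suc e)) s)" if "s \<in> I" for s
      using dn_sum_cmult[of "{..<l}" "\<lambda>e. y (Suc e)" "Suc m" 1 s c] yC l that
      by (simp add: Y_def dn_Suc)
    have Z: "dn i (\<lambda>t. d1 Y t - r t * Y t) t = 0" if i: "i < l" for i
    proof -
      have "dn i (\<lambda>t. d1 Y t - r t * Y t) t = dn i (\<lambda>s. \<Sum>e<l. c e * z e s) t"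
        by (rule dn_cong[OF _ t])
          (simp add: d1Y, simp add: Y_def z_def sum_distrib_left right_diff_distrib sum_subtractf mult.left_commute)
      also have "\<dots> = (\<Sum>e<l. c e * dn i (z e) t)"
        by (rule dn_sum_cmult[where k = m]) (use zC l i t in auto)
      finally show ?thesis using zz i by simp
    qed
    have "(\<Sum>e<Suc l. c' e * dn i (y e) t) = 0" if i: "i < Suc l" for i
    proof -
      have "0 = dn i (\<lambda>s. Y s - \<alpha> * v s) t"
        unfolding \<alpha>_def using quotient_zero_order[OF YC vC' vpos l t _ i] Z by (simp add: r_def)
      also have "\<dots> = dn i (\<lambda>s. \<Sum>e<Suc l. c' e * y e s) t"
        by (rule dn_cong[OF _ t])
          (simp add: c'_def Y_def v_def sum.lessThan_Suc_shift del: sum.lessThan_Suc)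
      also have "\<dots> = (\<Sum>e<Suc l. c' e * dn i (y e) t)"
        by (rule dn_sum_cmult[where k = "Suc m"]) (use yC l i t in auto)
      finally show ?thesis by simp
    qed
    from flag[OF _ t this, of "Suc e"] l e show "c e = 0" by (simp add: c'_def)
  qed (use zC in auto)
  moreover have "(\<Sum>h\<le>m. q h t * dn h (z e) t) = 0" if "e < m" "t \<in> I" for e t
    using q(3)[of "y (Suc e)" t] yC[of "Suc e"] Suc.prems(4)[of "Suc e" t] R0[of t] that
    by (simp add: z_def lessThan_Suc_atMost del: sum.atMost_Suc sum.lessThan_Suc)
  ultimately have "\<exists>w. (\<forall>l\<in>{1..m}. w l \<in> C (Suc s + m) \<and> (\<forall>t\<in>I. w l t > 0)) \<and>
      (\<forall>u\<in>C m. \<forall>t\<in>I. (\<Sum>h\<le>m. q h t * dn h u t) = (\<Prod>l=1..m. w l t) * Tseq a b w m u t)"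
    using q(1,2) Suc.prems(2) by (intro Suc.IH) (auto simp: less_Suc_eq_le)
  then obtain w where w: "\<And>l. l \<in> {1..m} \<Longrightarrow> w l \<in> C (Suc (s + m))"
    "\<And>l t. l \<in> {1..m} \<Longrightarrow> t \<in> I \<Longrightarrow> w l t > 0"
    "\<And>u t. u \<in> C m \<Longrightarrow> t \<in> I \<Longrightarrow>
      (\<Sum>h\<le>m. q h t * dn h u t) = (\<Prod>l=1..m. w l t) * Tseq a b w m u t"
    unfolding add_Suc by blast
  define x where "x l = (if l \<le> 1 then v else if l = 2 then (\<lambda>t. w 1 t / v t) else w (l - 1))" for l
  have vC2: "v \<in> C (Suc (s + m))" using vC by (simp add: add.commute)
  have "x l \<in> C (s + Suc m) \<and> (\<forall>t\<in>I. x l t > 0)" if l: "l \<in> {1..Suc m}" for l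
  proof -
    consider "l = 1" | "l = 2" "1 \<in> {1..m}" | "l - 1 \<in> {1..m}" "l > 2" using l by force
    then show ?thesis
    proof cases
      case 2
      then show ?thesis using C_divide[OF w(1)[of 1] vC2 v0] w(2)[of 1] vpos by (simp add: x_def)
    next
      case 3
      then show ?thesis using w(1,2)[of "l - 1"] by (simp add: x_def)
    qed (use vC2 vpos in \<open>simp add: x_def\<close>)
  qed
  moreover have "(\<Sum>h\<le>Suc m. k h t * dn h u t) = (\<Prod>l=1..Suc m. x l t) * Tseq a b x (Suc m) u t"
    if u: "u \<in> C (Suc m)" and t: "t \<in> I" for u t
  proof -
    have "(\<lambda>t. d1 u t - r t * u t) \<in> C m"
      using u rCm by (intro C_diff C_mult) (auto simp: C_Suc intro: C_decr)
    from w(3)[OF this t] q(3)[OF u t] R0[OF t]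
    have "(\<Sum>h\<le>Suc m. k h t * dn h u t) =
        (\<Prod>l=1..m. w l t) * Tseq a b w m (\<lambda>t. d1 u t - d1 v t / v t * u t) t"
      by (simp add: lessThan_Suc_atMost r_def del: sum.atMost_Suc sum.lessThan_Suc)
    also have "\<dots> = (\<Prod>l=1..Suc m. x l t) * Tseq a b x (Suc m) u t"
      using Tseq_merge[OF vpos u vC' t, of w m] by (simp only: x_def[abs_def])
    finally show ?thesis .
  qed
  ultimately show ?case by blast
qed

text \<open>Each step \<open>f \<mapsto> (f/w)'\<close> lowers the order of a zero by at most one.\<close>
lemma Tseq_zero:
  assumes "\<And>j. j \<in> {1..l} \<Longrightarrow> w j \<in> C k" "\<And>j t. j \<in> {1..l} \<Longrightarrow> t \<in> I \<Longrightarrow> w j t > 0"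
    and "u \<in> C k" "l \<le> k" "t \<in> I" "\<And>i. i \<le> l \<Longrightarrow> dn i u t = 0"
  shows "Tseq a b w l u t = 0"
proof -
  have "Tseq a b w j u \<in> C (k - j) \<and> (\<forall>i\<le>l - j. dn i (Tseq a b w j u) t = 0)" if "j \<le> l" for j
    using that
  proof (induction j)
    case 0
    then show ?case using assms by simp
  next
    case (Suc j)
    let ?T = "Tseq a b w j u" and ?v = "\<lambda>t. inverse (w (Suc j) t)"
    have T: "?T \<in> C (k - j)" "\<And>i. i \<le> l - j \<Longrightarrow> dn i ?T t = 0" using Suc by auto
    have v: "?v \<in> C (k - j)"
      by (rule C_inverse) (use assms(1,2)[of "Suc j"] Suc.prems in \<open>auto intro: C_mono\<close>, force)
    have Tv: "(\<lambda>t. ?T t * ?v t) \<in> C (k - j)" by (rule C_mult[OF T(1) v])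
    have eq: "Tseq a b w (Suc j) u = d1 (\<lambda>t. ?T t * ?v t)"
      by (simp add: divide_inverse)
    have "dn i (\<lambda>t. ?T t * ?v t) t = 0" if "i < Suc (l - j)" for i
      by (rule mult_zero_order[OF T(1) v _ assms(5) T(2) that]) (use assms(4) in auto)
    moreover have "k - j = Suc (k - Suc j)" using Suc.prems assms(4) by simp
    ultimately show ?case
      unfolding eq using Tv Suc.prems by (auto simp: C_Suc simp flip: dn_Suc_right)
  qed
  from this[of l] show ?thesis by auto
qed

end

section \<open>Existence of solutions of linear equations\<close>

context proper_interval begin

text \<open>Picard iteration, written as a series: \<open>P k\<close> is the \<open>k\<close>-th correction, obtained from the previous
  one by applying \<open>A\<close> and integrating. The bound \<open>M (L (t - a))\<^sup>k / k!\<close> makes the series of the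
  derivatives converge uniformly, so the sum may be differentiated term by term.\<close>
lemma linear_system_solution:
  fixes m :: nat
  assumes A: "\<And>i j. i < m \<Longrightarrow> j < m \<Longrightarrow> continuous_on I (A i j)"
  shows "\<exists>X. \<forall>i<m. X i a = d i \<and>
    (\<forall>t\<in>I. (X i has_real_derivative (\<Sum>j<m. A i j t * X j t)) (at t within I))"
proof -
  define P where "P = rec_nat (\<lambda>i t. d i) (\<lambda>k Q i t. integral {a..t} (\<lambda>s. \<Sum>j<m. A i j s * Q j s))"
  have P0: "P 0 i t = d i" and PS: "P (Suc k) i t = integral {a..t} (\<lambda>s. \<Sum>j<m. A i j s * P k j s)" for k i t
    by (simp_all add: P_def)
  have aI: "a \<in> I" using ab by simp
  have cont: "continuous_on I (P k i)" if "i < m" for k i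
    using that
  proof (induction k arbitrary: i)
    case 0
    then show ?case by (simp add: P0[abs_def])
  next
    case (Suc k)
    have "continuous_on I (\<lambda>s. \<Sum>j<m. A i j s * P k j s)"
      using Suc A by (intro continuous_intros) auto
    then show ?case
      unfolding PS[abs_def] by (intro indefinite_integral_continuous_1 integrable_continuous_interval)
  qed
  have cont_rhs: "continuous_on I (\<lambda>s. \<Sum>j<m. A i j s * P k j s)" if "i < m" for i k
    using that A cont by (intro continuous_intros) auto
  have "\<exists>B. \<forall>t\<in>I. \<forall>i<m. \<forall>j<m. \<bar>A i j t\<bar> \<le> B"
  proof -
    have "compact (A i j ` I)" if "i < m" "j < m" for i j
      using A that by (intro compact_continuous_image) auto
    then have "bounded (\<Union>i\<in>{..<m}. \<Union>j\<in>{..<m}. A i j ` I)"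
      by (intro bounded_UN finite_lessThan ballI compact_imp_bounded) auto
    then obtain B where B: "\<forall>x\<in>(\<Union>i\<in>{..<m}. \<Union>j\<in>{..<m}. A i j ` I). norm x \<le> B"
      unfolding bounded_iff by blast
    show ?thesis
    proof (intro exI ballI allI impI)
      fix t i j assume *: "t \<in> I" "i < m" "j < m"
      have "A i j t \<in> (\<Union>i\<in>{..<m}. \<Union>j\<in>{..<m}. A i j ` I)" using * by blast
      with B show "\<bar>A i j t\<bar> \<le> B" by (metis real_norm_def)
    qed
  qed
  then obtain B where B: "\<And>t i j. t \<in> I \<Longrightarrow> i < m \<Longrightarrow> j < m \<Longrightarrow> \<bar>A i j t\<bar> \<le> B" by blast
  define L where "L = real m * \<bar>B\<bar>"
  define M where "M = (\<Sum>i<m. \<bar>d i\<bar>)"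
  have L: "L \<ge> 0" and M: "M \<ge> 0" by (auto simp: L_def M_def intro: sum_nonneg)
  have rhs_bound: "\<bar>\<Sum>j<m. A i j s * P k j s\<bar> \<le> L * c"
    if "i < m" "s \<in> I" "\<And>j. j < m \<Longrightarrow> \<bar>P k j s\<bar> \<le> c" for i s k c
  proof -
    have "\<bar>\<Sum>j<m. A i j s * P k j s\<bar> \<le> (\<Sum>j<m. \<bar>A i j s * P k j s\<bar>)" by (rule sum_abs)
    also have "\<dots> \<le> (\<Sum>j<m. \<bar>B\<bar> * c)"
      using that B[OF that(2,1)] by (intro sum_mono) (force simp: abs_mult intro!: mult_mono)
    finally show ?thesis by (simp add: L_def)
  qed
  have P_bound: "\<bar>P k i t\<bar> \<le> M * (L * (t - a)) ^ k / fact k" if "i < m" "t \<in> I" for k i t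
    using that
  proof (induction k arbitrary: i t)
    case 0
    have "\<bar>d i\<bar> \<le> M" unfolding M_def using 0 by (intro member_le_sum) auto
    then show ?case by (simp add: P0)
  next
    case (Suc k)
    define G where "G s = M * (L * (s - a)) ^ Suc k / fact (Suc k)" for s
    define g where "g s = L * (M * (L * (s - a)) ^ k / fact k)" for s
    have sub: "{a..t} \<subseteq> I" using Suc.prems by auto
    have "(g has_integral (G t - G a)) {a..t}"
    proof (rule fundamental_theorem_of_calculus)
      show "(G has_vector_derivative g s) (at s within {a..t})" for s
      proof -
        have "((\<lambda>s. M / fact (Suc k) * (L * (s - a)) ^ Suc k) has_real_derivative
            M / fact (Suc k) * (real (Suc k) * (L * (s - a)) ^ k * L)) (at s within {a..t})"
          by (rule DERIV_cmult, rule DERIV_power[THEN DERIV_cong]) (auto intro!: derivative_eq_intros)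
        moreover have "M / fact (Suc k) * (real (Suc k) * (L * (s - a)) ^ k * L) = g s"
          by (simp add: g_def)
        ultimately show ?thesis
          by (simp add: G_def[abs_def] has_real_derivative_iff_has_vector_derivative[symmetric] del: fact_Suc power_Suc)
      qed
    qed (use Suc.prems in auto)
    then have g: "g integrable_on {a..t}" "integral {a..t} g = G t"
      by (auto simp: integral_unique G_def)
    have "\<bar>P (Suc k) i t\<bar> \<le> integral {a..t} g"
      unfolding PS real_norm_def[symmetric]
    proof (rule integral_norm_bound_integral)
      show "(\<lambda>s. \<Sum>j<m. A i j s * P k j s) integrable_on {a..t}"
        using cont_rhs[OF Suc.prems(1)] sub continuous_on_subset by (intro integrable_continuous_interval) blast
      show "norm (\<Sum>j<m. A i j s * P k j s) \<le> g s" if "s \<in> {a..t}" for s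
        unfolding g_def real_norm_def using that sub Suc by (intro rhs_bound) auto
    qed (rule g)
    then show ?case by (simp only: g(2)) (simp add: G_def)
  qed
  define f where "f n i t = (case n of 0 \<Rightarrow> 0 | Suc k \<Rightarrow> \<Sum>j<m. A i j t * P k j t)" for n i t
  define c where "c n = (case n of 0 \<Rightarrow> 0 | Suc k \<Rightarrow> L * (M * (L * (b - a)) ^ k / fact k))" for n
  have f_bound: "norm (f n i t) \<le> c n" if "i < m" "t \<in> I" for n i t
  proof (cases n)
    case (Suc k)
    have "\<bar>P k j t\<bar> \<le> M * (L * (b - a)) ^ k / fact k" if "j < m" for j
    proof -
      have "M * (L * (t - a)) ^ k / fact k \<le> M * (L * (b - a)) ^ k / fact k"
        using \<open>t \<in> I\<close> L M by (intro divide_right_mono mult_left_mono power_mono mult_nonneg_nonneg) auto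
      then show ?thesis using P_bound[OF that \<open>t \<in> I\<close>, of k] by linarith
    qed
    from rhs_bound[OF that this] show ?thesis by (simp add: Suc f_def c_def)
  qed (simp add: f_def c_def)
  have "summable c"
  proof -
    have "summable (\<lambda>k. (L * M) * (inverse (fact k) * (L * (b - a)) ^ k))"
      by (intro summable_mult summable_exp)
    then have "summable (\<lambda>k. c (Suc k))" by (simp add: c_def field_simps)
    then show ?thesis by (simp add: summable_Suc_iff)
  qed
  then have lim: "uniform_limit I (\<lambda>n t. \<Sum>k<n. f k i t) (\<lambda>t. \<Sum>k. f k i t) sequentially" if "i < m" for i
    using f_bound that by (intro Weierstrass_m_test) auto
  have Pf: "(P n i has_real_derivative f n i t) (at t within I)" if "i < m" "t \<in> I" for n i t
  proof (cases n)
    case 0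
    then show ?thesis by (simp add: P0[abs_def] f_def)
  next
    case (Suc k)
    then show ?thesis
      using integral_has_real_derivative[OF cont_rhs[OF that(1)] that(2)] by (simp add: PS[abs_def] f_def)
  qed
  have Pa: "(\<lambda>n. P n i a) sums d i" for i
  proof -
    have "P n i a = (if n = 0 then d i else 0)" for n by (cases n) (simp_all add: P0 PS)
    then show ?thesis using sums_single[of 0 "\<lambda>_. d i"] by simp
  qed
  have "\<exists>g. \<forall>t\<in>I. (\<lambda>n. P n i t) sums g t \<and> (g has_real_derivative (\<Sum>k. f k i t)) (at t within I)" if "i < m" for i
    using that by (intro has_field_derivative_series[OF _ Pf lim aI sums_summable[OF Pa]]) auto
  then obtain X where X: "\<And>i t. i < m \<Longrightarrow> t \<in> I \<Longrightarrow> (\<lambda>n. P n i t) sums X i t"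
    "\<And>i t. i < m \<Longrightarrow> t \<in> I \<Longrightarrow> (X i has_real_derivative (\<Sum>k. f k i t)) (at t within I)"
    by metis
  have "(\<Sum>k. f k i t) = (\<Sum>j<m. A i j t * X j t)" if "t \<in> I" for i t
  proof -
    have "(\<lambda>k. f (Suc k) i t) sums (\<Sum>j<m. A i j t * X j t)"
      using X(1) that unfolding f_def by (auto intro!: sums_sum sums_mult)
    then have "(\<lambda>k. f k i t) sums ((\<Sum>j<m. A i j t * X j t) + f 0 i t)"
      by (rule sums_Suc)
    then show ?thesis using sums_unique by (fastforce simp: f_def)
  qed
  then show ?thesis using X sums_unique2[OF _ Pa] aI by metis
qed

text \<open>The companion system; its component \<open>i\<close> is the \<open>i\<close>-th derivative of the solution.\<close>
lemma linear_ode_solution: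
  assumes k: "\<And>h. h < m \<Longrightarrow> continuous_on I (k h)"
  shows "\<exists>u\<in>C m. (\<forall>t\<in>I. dn m u t = - (\<Sum>h<m. k h t * dn h u t)) \<and> (\<forall>i<m. dn i u a = d i)"
proof (cases m)
  case 0
  then show ?thesis using C_const[of 0] by (intro bexI[of _ "\<lambda>t. 0"]) auto
next
  case (Suc m')
  define A where "A i j t = (if Suc i < m then (if j = Suc i then 1 else 0) else - k j t)" for i j t
  have "continuous_on I (A i j)" if "i < m" "j < m" for i j
    unfolding A_def using k that by (cases "Suc i < m") (auto intro: continuous_intros)
  then obtain X where X: "\<And>i. i < m \<Longrightarrow> X i a = d i"
    "\<And>i t. i < m \<Longrightarrow> t \<in> I \<Longrightarrow> (X i has_real_derivative (\<Sum>j<m. A i j t * X j t)) (at t within I)"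
    using linear_system_solution[of m A d] by blast
  have A1: "(\<Sum>j<m. A i j t * X j t) = X (Suc i) t" if "Suc i < m" for i t
    using that by (simp add: A_def sum.delta if_distrib[of "\<lambda>x. x * _"] cong: if_cong)
  have A2: "(\<Sum>j<m. A m' j t * X j t) = - (\<Sum>h<m. k h t * X h t)" for t
    using Suc by (simp add: A_def sum_negf)
  have XI: "dn i (X 0) t = X i t" if "i < m" "t \<in> I" for i t
    using that
  proof (induction i arbitrary: t)
    case (Suc i)
    have "dn (Suc i) (X 0) t = d1 (X i) t"
      unfolding dn_Suc using Suc by (intro d1_cong) auto
    then show ?case using d1_eqI[OF X(2)[of i t]] A1 Suc.prems by simp
  qed simp
  have top: "dn m (X 0) t = - (\<Sum>h<m. k h t * dn h (X 0) t)" if t: "t \<in> I" for t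
  proof -
    have "dn m (X 0) t = d1 (X m') t"
      unfolding Suc dn_Suc using XI Suc t by (intro d1_cong) auto
    also have "\<dots> = - (\<Sum>h<m. k h t * X h t)"
      using d1_eqI[OF X(2)[of m' t] t] A2 Suc t by simp
    finally show ?thesis using XI t by simp
  qed
  have cX: "continuous_on I (X i)" if "i < m" for i
    by (rule DERIV_continuous_on[OF X(2)[OF that]])
  have "dn i (X 0) differentiable_on I" if "i < m" for i
    by (rule differentiable_on_cong[of "X i"])
      (use XI that differentiable_on_if_has_derivative[OF X(2)] in auto)
  moreover have "continuous_on I (dn m (X 0))"
  proof -
    have "continuous_on I (\<lambda>t. - (\<Sum>h<m. k h t * X h t))"
      using k cX by (intro continuous_intros) auto
    then show ?thesis by (rule continuous_on_eq) (simp add: top XI)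
  qed
  ultimately have "X 0 \<in> C m" by (simp add: Ck_def)
  then show ?thesis using top XI X(1) ab by (intro bexI[of _ "X 0"]) auto
qed

end

section \<open>Moving a zero past the left end of the interval\<close>

lemma Rolle_many_zeros:
  fixes f f' :: "real \<Rightarrow> real"
  assumes "continuous_on {c..t} f"
    and "\<And>x. c < x \<Longrightarrow> x < t \<Longrightarrow> (f has_real_derivative f' x) (at x)"
    and "finite A" "A \<noteq> {}" "A \<subseteq> {c..t}" "\<And>x. x \<in> A \<Longrightarrow> f x = 0"
  shows "\<exists>B. finite B \<and> B \<subseteq> {c<..<Max A} \<and> Suc (card B) = card A \<and> (\<forall>x\<in>B. f' x = 0)"
  using assms(3-)
proof (induction A rule: finite_linorder_max_induct)
  case (insert x A)
  have Mx: "Max (insert x A) = x" 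
    using insert.hyps by (intro Max_eqI) (auto intro: less_imp_le)
  have x: "x \<notin> A" using insert.hyps by auto
  show ?case
  proof (cases "A = {}")
    case True
    then show ?thesis by (intro exI[of _ "{}"]) auto
  next
    case False
    then obtain B where B: "finite B" "B \<subseteq> {c<..<Max A}" "Suc (card B) = card A" "\<forall>x\<in>B. f' x = 0"
      using insert by auto
    have M: "Max A \<in> A" using False insert.hyps by simp
    have cM: "c \<le> Max A" "Max A < x" "x \<le> t" "f (Max A) = 0" "f x = 0" using M insert.hyps insert.prems by auto
    obtain z where z: "Max A < z" "z < x" "DERIV f z :> 0"
    proof -
      have "continuous_on {Max A..x} f" by (rule continuous_on_subset[OF assms(1)]) (use cM in auto)
      moreover have "f differentiable (at y)" if "Max A < y" "y < x" for y
        using assms(2)[of y] that cM by (force simp: real_differentiable_def)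
      ultimately show ?thesis using Rolle[of "Max A" x f] cM that by auto
    qed
    have "f' z = 0" using DERIV_unique[OF z(3) assms(2)[of z]] z cM by simp
    moreover have "z \<notin> B" using B z by auto
    ultimately show ?thesis
      unfolding Mx using B z cM x insert.hyps by (intro exI[of _ "insert z B"]) force
  qed
qed simp

text \<open>Counting zeros: passing from \<open>F i\<close> to \<open>F (Suc i)\<close>, Rolle's theorem produces one zero inside each gap
  between neighbouring zeros of \<open>F i\<close>, while \<open>c\<close> and \<open>t\<close> remain zeros as long as \<open>i < p\<close> and \<open>i < q\<close>. This
  keeps at least one zero of \<open>F i\<close> for every \<open>i < p + q\<close>.\<close>
lemma two_point_Rolle:
  fixes F :: "nat \<Rightarrow> real \<Rightarrow> real"
  assumes ct: "c < t" and cont: "\<And>i. i < p + q \<Longrightarrow> continuous_on {c..t} (F i)"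
    and deriv: "\<And>i x. Suc i < p + q \<Longrightarrow> c < x \<Longrightarrow> x < t \<Longrightarrow> (F i has_real_derivative F (Suc i) x) (at x)"
    and c: "\<And>i. i < p \<Longrightarrow> F i c = 0" and t: "\<And>i. i < q \<Longrightarrow> F i t = 0" and i: "i < p + q"
  shows "\<exists>\<xi>\<in>{c..t}. F i \<xi> = 0"
proof -
  define ends where "ends i = (if i < p then {c} else {}) \<union> (if i < q then {t} else {})" for i
  \<comment> \<open>For \<open>B\<close> the interior zeros, \<open>B \<union> ends i\<close> collects all zeros of \<open>F i\<close> that are tracked.\<close>
  have card_ends: "card (B \<union> ends i) + i = min (Suc i) p + min (Suc i) q"
    "finite (B \<union> ends i)" "B \<union> ends i \<subseteq> {c..t}" "\<And>x. x \<in> B \<union> ends i \<Longrightarrow> F i x = 0"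
    if B: "finite B" "B \<subseteq> {c<..<t}" "card B + i = min i p + min i q" "\<forall>x\<in>B. F i x = 0" for B i
  proof -
    have "card (B \<union> ends i) = card B + card (ends i)"
      using B by (intro card_Un_disjoint) (auto simp: ends_def)
    moreover have "card (ends i) = (if i < p then 1 else 0) + (if i < q then 1 else 0)"
      using ct by (auto simp: ends_def)
    ultimately show "card (B \<union> ends i) + i = min (Suc i) p + min (Suc i) q"
      using B(3) by (auto split: if_splits)
    show "finite (B \<union> ends i)" "B \<union> ends i \<subseteq> {c..t}" "\<And>x. x \<in> B \<union> ends i \<Longrightarrow> F i x = 0"
      using B c t ct by (auto simp: ends_def split: if_splits)
  qed
  have "\<exists>B. finite B \<and> B \<subseteq> {c<..<t} \<and> card B + i = min i p + min i q \<and> (\<forall>x\<in>B. F i x = 0)"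
    using i
  proof (induction i)
    case 0
    then show ?case by (intro exI[of _ "{}"]) auto
  next
    case (Suc i)
    then obtain B where B: "finite B" "B \<subseteq> {c<..<t}" "card B + i = min i p + min i q" "\<forall>x\<in>B. F i x = 0"
      by auto
    note A = card_ends[OF B]
    have "card (B \<union> ends i) \<noteq> 0" using A(1) Suc.prems by auto
    then have ne: "B \<union> ends i \<noteq> {}" by force
    obtain B' where B': "finite B'" "B' \<subseteq> {c<..<Max (B \<union> ends i)}" "Suc (card B') = card (B \<union> ends i)"
      "\<forall>x\<in>B'. F (Suc i) x = 0"
      using Rolle_many_zeros[of c t "F i" "F (Suc i)", OF _ _ A(2) ne A(3,4)] cont deriv Suc.prems by auto
    have "Max (B \<union> ends i) \<le> t" using A(3) Max_in[OF A(2) ne] by auto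
    then show ?case using B' A(1) by (intro exI[of _ B']) auto
  qed
  then obtain B where B: "finite B" "B \<subseteq> {c<..<t}" "card B + i = min i p + min i q" "\<forall>x\<in>B. F i x = 0"
    by auto
  note A = card_ends[OF B]
  have "card (B \<union> ends i) \<noteq> 0" using A(1) i by auto
  then obtain \<xi> where "\<xi> \<in> B \<union> ends i" by (metis all_not_in_conv card.empty)
  then show ?thesis using A(3,4) by blast
qed

lemma common_convergent_subsequence:
  fixes d :: "nat \<Rightarrow> nat \<Rightarrow> real"
  assumes "\<And>j k. j < m \<Longrightarrow> \<bar>d k j\<bar> \<le> B"
  shows "\<exists>r l. strict_mono (r :: nat \<Rightarrow> nat) \<and> (\<forall>j<m. (\<lambda>k. d (r k) j) \<longlonglongrightarrow> l j)"
  using assms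
proof (induction m)
  case 0
  then show ?case using strict_mono_id by auto
next
  case (Suc m)
  then obtain r l where r: "strict_mono (r :: nat \<Rightarrow> nat)" "\<And>j. j < m \<Longrightarrow> (\<lambda>k. d (r k) j) \<longlonglongrightarrow> l j"
    by force
  have "d (r k) m \<in> {-B..B}" for k using Suc.prems[of m "r k"] by (simp add: abs_le_iff minus_le_iff)
  then obtain x r' where r': "strict_mono (r' :: nat \<Rightarrow> nat)" "((\<lambda>k. d (r k) m) \<circ> r') \<longlonglongrightarrow> x"
    using compact_Icc[of "-B" B] unfolding compact_eq_seq_compact_metric seq_compact_def by metis
  have "(\<lambda>k. d (r (r' k)) j) \<longlonglongrightarrow> (l(m := x)) j" if "j < Suc m" for j
    using that r' LIMSEQ_subseq_LIMSEQ[OF r(2) r'(1), of j] by (auto simp: o_def less_Suc_eq)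
  then show ?case using strict_mono_o[OF r(1) r'(1)]
    by (intro exI[of _ "r \<circ> r'"] exI[of _ "l(m := x)"]) (auto simp: o_def)
qed

text \<open>The \<open>i\<close>-th derivative of \<open>x\<^sup>j/j!\<close>. As \<open>d \<mapsto> \<Sum>\<^sub>j d\<^sub>j x\<^sup>j/j!\<close> gives the polynomial with derivatives \<open>d\<^sub>j\<close>
  at \<open>0\<close>, this normalization makes coefficient vectors equal to vectors of initial values.\<close>
definition monom_deriv :: "nat \<Rightarrow> nat \<Rightarrow> real \<Rightarrow> real" where
  "monom_deriv j i x = (if i \<le> j then x ^ (j - i) / fact (j - i) else 0)"

lemma monom_deriv_0: "monom_deriv j i 0 = (if i = j then 1 else 0)"
  by (simp add: monom_deriv_def power_0_left)

lemma monom_deriv_has_derivative: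
  "(monom_deriv j i has_real_derivative monom_deriv j (Suc i) x) (at x within S)"
proof (cases "i < j")
  case True
  then obtain n where n: "j - i = Suc n" "j - Suc i = n" by (metis Suc_diff_Suc)
  have "((\<lambda>x. x ^ Suc n / fact (Suc n)) has_real_derivative (real (Suc n) * x ^ n) / fact (Suc n)) (at x within S)"
    by (rule DERIV_cdivide, rule DERIV_power[THEN DERIV_cong]) (auto intro!: derivative_eq_intros)
  also have "(real (Suc n) * x ^ n) / fact (Suc n) = x ^ n / fact n" by simp
  finally show ?thesis using True n by (simp add: monom_deriv_def[abs_def])
next
  case False
  then have "monom_deriv j i = (\<lambda>x. if i = j then 1 else 0)" "monom_deriv j (Suc i) x = 0"
    by (auto simp: monom_deriv_def)
  then show ?thesis by simp
qed

lemma isCont_monom_deriv: "isCont (monom_deriv j i) x"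
  by (rule DERIV_isCont[OF monom_deriv_has_derivative])

text \<open>Taylor's formula for the monomial \<open>z\<^sup>E/E!\<close> at \<open>x\<close>, differentiated \<open>i\<close> times; it is the binomial
  theorem.\<close>
lemma monom_deriv_Taylor:
  assumes "E < m"
  shows "(\<Sum>j<m. monom_deriv E j x * monom_deriv j i y) = monom_deriv E i (x + y)"
proof (cases "i \<le> E")
  case True
  have "(\<Sum>j<m. monom_deriv E j x * monom_deriv j i y) = (\<Sum>j=i..E. monom_deriv E j x * monom_deriv j i y)"
    using assms by (intro sum.mono_neutral_right) (auto simp: monom_deriv_def)
  also have "\<dots> = (\<Sum>k\<le>E - i. (y ^ k /\<^sub>R fact k) * (x ^ (E - i - k) /\<^sub>R fact (E - i - k)))"
    using True by (intro sum.reindex_bij_witness[of _ "\<lambda>k. k + i" "\<lambda>j. j - i"])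
      (auto simp: monom_deriv_def divide_inverse mult_ac)
  also have "\<dots> = (y + x) ^ (E - i) /\<^sub>R fact (E - i)"
    by (rule exp_series_add_commuting[symmetric]) simp
  also have "\<dots> = monom_deriv E i (x + y)"
    using True by (simp add: monom_deriv_def divide_inverse add.commute mult.commute)
  finally show ?thesis .
qed (auto simp: monom_deriv_def intro!: sum.neutral)

lemma sum_mult_indicator:
  fixes d :: "nat \<Rightarrow> real"
  assumes "i < m"
  shows "(\<Sum>j<m. d j * (if i = j then 1 else 0)) = d i"
proof -
  have "(\<Sum>j<m. d j * (if i = j then 1 else 0)) = (\<Sum>j<m. if i = j then d j else 0)"
    by (intro sum.cong) auto
  then show ?thesis using assms by simp
qed

context proper_interval begin

text \<open>The \<open>i\<close>-th derivative of the solution \<open>\<phi>\<^sub>j\<close> with initial values \<open>\<phi>\<^sub>j\<^sup>(\<^sup>i\<^sup>)(a) = \<delta>\<^sub>i\<^sub>j\<close>, continued to the left of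
  \<open>a\<close> by its Taylor polynomial there. The continuation is of class \<open>C\<^sup>m\<^sup>-\<^sup>1\<close>, which suffices for counting up to \<open>m\<close>
  zeros with Rolle's theorem.\<close>
definition Taylor_ext :: "(nat \<Rightarrow> real \<Rightarrow> real) \<Rightarrow> nat \<Rightarrow> nat \<Rightarrow> real \<Rightarrow> real" where
  "Taylor_ext \<phi> j i x = (if x \<le> a then monom_deriv j i (x - a) else dn i (\<phi> j) x)"

lemma
  assumes \<phi>: "\<phi> j \<in> C m" and \<phi>a: "\<And>i. i < m \<Longrightarrow> dn i (\<phi> j) a = (if i = j then 1 else 0)"
  shows continuous_on_Taylor_ext: "i < m \<Longrightarrow> continuous_on {..b} (Taylor_ext \<phi> j i)"
    and Taylor_ext_has_derivative: "Suc i < m \<Longrightarrow> x < b \<Longrightarrow>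
      (Taylor_ext \<phi> j i has_real_derivative Taylor_ext \<phi> j (Suc i) x) (at x)"
proof -
  show "continuous_on {..b} (Taylor_ext \<phi> j i)" if i: "i < m"
    unfolding Taylor_ext_def
  proof (rule continuous_on_cases_le)
    show "continuous_on {t \<in> {..b}. t \<le> a} (\<lambda>x. monom_deriv j i (x - a))"
      by (intro continuous_at_imp_continuous_on ballI isCont_o2[OF _ isCont_monom_deriv] continuous_intros)
    have "{t \<in> {..b}. a \<le> t} = I" by auto
    then show "continuous_on {t \<in> {..b}. a \<le> t} (dn i (\<phi> j))"
      using C_continuous_on[OF C_dn_le[OF \<phi>, of i 0]] i by simp
  qed (use \<phi>a i in \<open>auto simp: monom_deriv_0 intro: continuous_intros\<close>)
  show "(Taylor_ext \<phi> j i has_real_derivative Taylor_ext \<phi> j (Suc i) x) (at x)" if i: "Suc i < m" and x: "x < b"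
  proof -
    have M: "((\<lambda>x. monom_deriv j i (x - a)) has_real_derivative monom_deriv j (Suc i) (x - a)) (at x within S)" for S
    proof -
      have "((\<lambda>x. x - a) has_real_derivative 1) (at x within S)"
        by (auto intro!: derivative_eq_intros)
      from DERIV_chain2[OF monom_deriv_has_derivative this] show ?thesis by simp
    qed
    have D: "(dn i (\<phi> j) has_real_derivative dn (Suc i) (\<phi> j) x) (at x within I)" if "x \<in> I"
      by (rule C_has_derivative[OF \<phi>]) (use i that in auto)
    consider "x < a" | "x = a" | "a < x" by linarith
    then show ?thesis
    proof cases
      case 1
      have "(Taylor_ext \<phi> j i has_real_derivative monom_deriv j (Suc i) (x - a)) (at x)"
        by (rule has_field_derivative_transform_within_open[OF M, of "{..<a}"])
          (use 1 in \<open>auto simp: Taylor_ext_def\<close>)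
      then show ?thesis using 1 by (simp add: Taylor_ext_def)
    next
      case 2
      have left: "(Taylor_ext \<phi> j i has_real_derivative Taylor_ext \<phi> j (Suc i) x) (at x within {..a})"
        using 2 by (intro has_field_derivative_transform_within[OF M, of 1, THEN DERIV_cong])
          (auto simp: Taylor_ext_def)
      have "(Taylor_ext \<phi> j i has_real_derivative dn (Suc i) (\<phi> j) x) (at x within I)"
        by (rule has_field_derivative_transform_within[OF D, of 1])
          (use 2 ab \<phi>a[of i] i in \<open>auto simp: Taylor_ext_def monom_deriv_0 split: if_splits\<close>)
      moreover have "dn (Suc i) (\<phi> j) x = Taylor_ext \<phi> j (Suc i) x"
        using 2 \<phi>a[OF i] by (simp add: Taylor_ext_def monom_deriv_0)
      ultimately have "(Taylor_ext \<phi> j i has_real_derivative Taylor_ext \<phi> j (Suc i) x) (at x within {..a} \<union> I)"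
        using left by (simp only: has_field_derivative_iff) (simp add: at_within_union filterlim_sup)
      moreover have "at x within {..a} \<union> I = at x"
        by (rule at_within_open_subset[of x "{..<b}"]) (use x ab in auto)
      ultimately show ?thesis by simp
    next
      case 3
      then have "(dn i (\<phi> j) has_real_derivative dn (Suc i) (\<phi> j) x) (at x)"
        using D x by (simp add: at_within_Icc_at)
      then have "(Taylor_ext \<phi> j i has_real_derivative dn (Suc i) (\<phi> j) x) (at x)"
        by (rule has_field_derivative_transform_within_open[of _ _ _ "{a<..}"])
          (use 3 in \<open>auto simp: Taylor_ext_def\<close>)
      then show ?thesis using 3 by (simp add: Taylor_ext_def)
    qed
  qed
qed

text \<open>The vector \<open>d\<close> stands for the solution \<open>\<Sum>\<^sub>j d\<^sub>j \<phi>\<^sub>j\<close> with initial values \<open>d\<close> at \<open>a\<close>. Suppose that for a sequence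
  \<open>\<epsilon> \<rightarrow> 0\<close> there are such nontrivial solutions whose Taylor polynomial has a \<open>p\<close>-fold zero at
  \<open>- \<epsilon>\<close>, relative to \<open>a\<close>, and which have a \<open>q\<close>-fold zero at some \<open>t\<close>. Scale \<open>d\<close> to norm one and pass to a limit
  \<open>l \<noteq> 0\<close>, \<open>t \<rightarrow> \<tau>\<close>. If \<open>\<tau> > a\<close>, the limit has zeros as excluded by \<open>H\<close>. If \<open>\<tau> = a\<close>, then by
  Rolle's theorem each derivative of order below \<open>m\<close> of the continued solutions has a zero between
  \<open>a - \<epsilon>\<close> and \<open>t\<close>, so that all initial values of the limit are zero.\<close>
lemma perturbed_zero_at_left_end:
  assumes \<phi>: "\<And>j. j < m \<Longrightarrow> \<phi> j \<in> C m" 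
    and \<phi>a: "\<And>i j. i < m \<Longrightarrow> j < m \<Longrightarrow> dn i (\<phi> j) a = (if i = j then 1 else 0)"
    and pq: "p + q = m"
    and H: "\<And>d t j. t \<in> I \<Longrightarrow> a < t \<Longrightarrow> (\<And>i. i < p \<Longrightarrow> d i = 0) \<Longrightarrow>
      (\<And>i. i < q \<Longrightarrow> (\<Sum>j<m. d j * dn i (\<phi> j) t) = 0) \<Longrightarrow> j < m \<Longrightarrow> d j = 0"
  shows "\<forall>\<^sub>F \<epsilon> in at_right 0. \<forall>d. \<forall>t\<in>I.
    (\<forall>i<p. (\<Sum>j<m. d j * monom_deriv j i (- \<epsilon>)) = 0) \<longrightarrow>
    (\<forall>i<q. (\<Sum>j<m. d j * dn i (\<phi> j) t) = 0) \<longrightarrow> (\<forall>j<m. d j = 0)"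
proof (rule ccontr)
  assume neg: "\<not> ?thesis"
  define bad where "bad k \<epsilon> d t \<longleftrightarrow>
    0 < \<epsilon> \<and> \<epsilon> < inverse (Suc k) \<and> t \<in> I \<and> (\<Sum>j<m. \<bar>d j\<bar>) = 1 \<and>
    (\<forall>i<p. (\<Sum>j<m. d j * monom_deriv j i (- \<epsilon>)) = 0) \<and>
    (\<forall>i<q. (\<Sum>j<m. d j * dn i (\<phi> j) t) = 0)" for k :: nat and \<epsilon> d t
  have "\<exists>\<epsilon> d t. bad k \<epsilon> d t" for k
  proof -
    have "inverse (real (Suc k)) > 0" by simp
    with neg obtain \<epsilon> d t where *: "0 < \<epsilon>" "\<epsilon> < inverse (Suc k)" "t \<in> I" "\<not> (\<forall>j<m. d j = 0)"
      "\<forall>i<p. (\<Sum>j<m. d j * monom_deriv j i (- \<epsilon>)) = 0" "\<forall>i<q. (\<Sum>j<m. d j * dn i (\<phi> j) t) = 0"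
      unfolding eventually_at_right_field by blast
    define N where "N = (\<Sum>j<m. \<bar>d j\<bar>)"
    have "N \<noteq> 0" using *(4) by (auto simp: N_def sum_nonneg_eq_0_iff)
    moreover have "N \<ge> 0" by (simp add: N_def sum_nonneg)
    ultimately have N: "N > 0" by simp
    have "(\<Sum>j<m. \<bar>d j / N\<bar>) = 1" using N by (simp add: N_def[symmetric] sum_divide_distrib[symmetric])
    moreover have "(\<Sum>j<m. d j / N * f j) = (\<Sum>j<m. d j * f j) / N" for f
      by (simp add: sum_divide_distrib)
    ultimately show ?thesis unfolding bad_def using * by (intro exI[of _ \<epsilon>] exI[of _ "\<lambda>j. d j / N"] exI[of _ t]) simp
  qed
  then obtain e d t where "\<And>k. bad k (e k) (d k) (t k)" by metis
  then have e: "\<And>k. 0 < e k" "\<And>k. e k < inverse (Suc k)" and t: "\<And>k. t k \<in> I"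
    and d1: "\<And>k. (\<Sum>j<m. \<bar>d k j\<bar>) = 1"
    and dp: "\<And>k i. i < p \<Longrightarrow> (\<Sum>j<m. d k j * monom_deriv j i (- e k)) = 0"
    and dq: "\<And>k i. i < q \<Longrightarrow> (\<Sum>j<m. d k j * dn i (\<phi> j) (t k)) = 0"
    unfolding bad_def by blast+
  \<comment> \<open>The points \<open>t k\<close> become an extra coordinate, so that one subsequence serves for everything.\<close>
  define D where "D k j = (if j < m then d k j else t k)" for k j
  have "\<bar>D k j\<bar> \<le> 1 + \<bar>a\<bar> + \<bar>b\<bar>" for k j
  proof (cases "j < m")
    case True
    then have "\<bar>d k j\<bar> \<le> (\<Sum>j<m. \<bar>d k j\<bar>)" by (intro member_le_sum) auto
    then show ?thesis using True d1[of k] by (simp add: D_def)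
  next
    case False
    have "\<bar>t k\<bar> \<le> 1 + \<bar>a\<bar> + \<bar>b\<bar>"
      using t[of k] unfolding atLeastAtMost_iff by arith
    then show ?thesis using False by (simp add: D_def)
  qed
  then obtain r l where r: "strict_mono (r :: nat \<Rightarrow> nat)"
    and l: "\<And>j. j < Suc m \<Longrightarrow> (\<lambda>k. D (r k) j) \<longlonglongrightarrow> l j"
    using common_convergent_subsequence[of "Suc m" D] by metis
  define \<tau> where "\<tau> = l m"
  have dl: "(\<lambda>k. d (r k) j) \<longlonglongrightarrow> l j" if "j < m" for j using l[of j] that by (simp add: D_def)
  have tl: "(\<lambda>k. t (r k)) \<longlonglongrightarrow> \<tau>" using l[of m] by (simp add: D_def \<tau>_def)
  have \<tau>: "\<tau> \<in> I" by (rule closed_sequentially[OF closed_atLeastAtMost _ tl]) (rule t)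
  have "e \<longlonglongrightarrow> 0"
    by (rule tendsto_sandwich[OF _ _ tendsto_const LIMSEQ_inverse_real_of_nat])
      (use e less_imp_le in \<open>auto intro!: always_eventually\<close>)
  then have el: "(\<lambda>k. e (r k)) \<longlonglongrightarrow> 0" using LIMSEQ_subseq_LIMSEQ[OF _ r] by (auto simp: o_def)
  have lim_zero: "(\<Sum>j<m. l j * f j \<xi>) = 0"
    if "\<And>j. j < m \<Longrightarrow> (\<lambda>k. f j (x k)) \<longlonglongrightarrow> f j \<xi>" "\<And>k. (\<Sum>j<m. d (r k) j * f j (x k)) = 0" 
    for f :: "nat \<Rightarrow> real \<Rightarrow> real" and x \<xi>
  proof -
    have "(\<lambda>k. \<Sum>j<m. d (r k) j * f j (x k)) \<longlonglongrightarrow> (\<Sum>j<m. l j * f j \<xi>)"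
      using that(1) dl by (intro tendsto_intros) auto
    then show ?thesis using that(2) by (simp add: LIMSEQ_const_iff)
  qed
  have "l j = 0" if "j < m" for j
  proof (cases "a < \<tau>")
    case True
    show ?thesis
    proof (rule H[OF \<tau> True _ _ that])
      show "l i = 0" if "i < p" for i
      proof -
        have "(\<Sum>j<m. l j * monom_deriv j i 0) = 0"
          by (rule lim_zero[where x = "\<lambda>k. - e (r k)"])
            (use dp that tendsto_minus[OF el] isCont_monom_deriv in \<open>auto intro: isCont_tendsto_compose\<close>)
        then show ?thesis using sum_mult_indicator[of i m l] that pq by (simp add: monom_deriv_0)
      qed
      show "(\<Sum>j<m. l j * dn i (\<phi> j) \<tau>) = 0" if i: "i < q" for i
      proof (rule lim_zero[where x = "\<lambda>k. t (r k)"])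
        show "(\<lambda>k. dn i (\<phi> j) (t (r k))) \<longlonglongrightarrow> dn i (\<phi> j) \<tau>" if "j < m" for j
          using C_continuous_on[OF C_dn_le[OF \<phi>[OF that], of i 0]] i pq \<tau> t tl
          by (intro continuous_on_tendsto_compose[of I "dn i (\<phi> j)"]) auto
      qed (rule dq[OF i])
    qed
  next
    case False
    then have \<tau>a: "\<tau> = a" using \<tau> by simp
    note ext = continuous_on_Taylor_ext[of "\<phi>" _ m, OF \<phi> \<phi>a] Taylor_ext_has_derivative[of "\<phi>" _ m, OF \<phi> \<phi>a]
    have "\<exists>\<xi>. \<xi> \<in> {a - e k..t k} \<and> (\<Sum>j'<m. d k j' * Taylor_ext \<phi> j' j \<xi>) = 0" for k
    proof -
      have "\<exists>\<xi>\<in>{a - e k..t k}. (\<Sum>j'<m. d k j' * Taylor_ext \<phi> j' j \<xi>) = 0"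
      proof (rule two_point_Rolle[where p = p and q = q and F = "\<lambda>i x. \<Sum>j'<m. d k j' * Taylor_ext \<phi> j' i x"])
        show "a - e k < t k" using e(1)[of k] t[of k] by auto
        show "continuous_on {a - e k..t k} (\<lambda>x. \<Sum>j'<m. d k j' * Taylor_ext \<phi> j' i x)" if "i < p + q" for i
          using that pq t[of k]
          by (intro continuous_intros continuous_on_subset[OF ext(1)]) auto
        show "((\<lambda>x. \<Sum>j'<m. d k j' * Taylor_ext \<phi> j' i x) has_real_derivative
            (\<Sum>j'<m. d k j' * Taylor_ext \<phi> j' (Suc i) x)) (at x)" if "Suc i < p + q" "x < t k" for i x
          using that pq t[of k] by (intro DERIV_sum DERIV_cmult ext(2)) auto
        show "(\<Sum>j'<m. d k j' * Taylor_ext \<phi> j' i (a - e k)) = 0" if "i < p" for i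
          using dp[OF that, of k] e(1)[of k] by (simp add: Taylor_ext_def)
        show "(\<Sum>j'<m. d k j' * Taylor_ext \<phi> j' i (t k)) = 0" if "i < q" for i
        proof -
          have "Taylor_ext \<phi> j' i (t k) = dn i (\<phi> j') (t k)" if "j' < m" for j'
            using \<phi>a[of i j'] that \<open>i < q\<close> pq t[of k] by (auto simp: Taylor_ext_def monom_deriv_0)
          then show ?thesis using dq[OF that, of k] by simp
        qed
      qed (use that pq in auto)
      then show ?thesis by blast
    qed
    then obtain \<xi> where \<xi>: "\<And>k. \<xi> k \<in> {a - e k..t k}" "\<And>k. (\<Sum>j'<m. d k j' * Taylor_ext \<phi> j' j (\<xi> k)) = 0"
      by metis
    have \<xi>l: "(\<lambda>k. \<xi> (r k)) \<longlonglongrightarrow> a"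
    proof (rule tendsto_sandwich)
      show "(\<lambda>k. a - e (r k)) \<longlonglongrightarrow> a" using tendsto_diff[OF tendsto_const el, of a] by simp
      show "(\<lambda>k. t (r k)) \<longlonglongrightarrow> a" using tl \<tau>a by simp
    qed (use \<xi>(1) in \<open>auto intro!: always_eventually\<close>)
    have "(\<Sum>j'<m. l j' * Taylor_ext \<phi> j' j a) = 0"
    proof (rule lim_zero[where x = "\<lambda>k. \<xi> (r k)" and f = "\<lambda>j'. Taylor_ext \<phi> j' j"])
      show "(\<lambda>k. Taylor_ext \<phi> j' j (\<xi> (r k))) \<longlonglongrightarrow> Taylor_ext \<phi> j' j a" if "j' < m" for j'
      proof (rule continuous_on_tendsto_compose[OF ext(1) \<xi>l])
        show "\<forall>\<^sub>F k in sequentially. \<xi> (r k) \<in> {..b}"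
          using \<xi>(1) t by (intro always_eventually allI) (meson atLeastAtMost_iff atMost_iff order_trans)
      qed (use that \<open>j < m\<close> ab in auto)
    qed (rule \<xi>(2))
    then show ?thesis using sum_mult_indicator[OF that, of l] by (simp add: Taylor_ext_def monom_deriv_0)
  qed
  moreover have "(\<lambda>k. \<Sum>j<m. \<bar>d (r k) j\<bar>) \<longlonglongrightarrow> (\<Sum>j<m. \<bar>l j\<bar>)"
    using dl by (intro tendsto_intros) auto
  ultimately show False using d1 by (simp add: LIMSEQ_const_iff)
qed

end

section \<open>From disconjugacy to a factorization\<close>

context proper_interval begin

text \<open>Disconjugacy in a form that hides the exact multiplicities: lower bounds \<open>r\<close> for them at finitely
  many points are enough.\<close>
lemma disconjugate_zeros:
  assumes disc: "disconjugate a b m L" and u: "u \<in> C m" "\<And>t. t \<in> I \<Longrightarrow> L u t = 0"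
    and J: "finite J" "J \<subseteq> I" "m \<le> sum r J"
    and r: "\<And>t. t \<in> J \<Longrightarrow> r t \<le> m" "\<And>t i. t \<in> J \<Longrightarrow> i < r t \<Longrightarrow> dn i u t = 0"
    and t: "t \<in> I"
  shows "u t = 0"
proof (rule ccontr)
  assume "u t \<noteq> 0"
  define Z where "Z = {t\<in>I. u t = 0}"
  have Z: "finite Z" "sum (zero_mult a b m u) Z < m"
    using disc u t \<open>u t \<noteq> 0\<close> unfolding disconjugate_def Z_def by blast+
  have "r s \<le> zero_mult a b m u s" if "s \<in> J" for s
    unfolding zero_mult_def using r that by (intro Max_ge) (auto intro: finite_subset[of _ "{..m}"])
  then have "sum r {s\<in>J. r s > 0} \<le> sum (zero_mult a b m u) {s\<in>J. r s > 0}"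
    by (intro sum_mono) auto
  also have "\<dots> \<le> sum (zero_mult a b m u) Z"
    using Z(1) J(2) r(2)[of _ 0] by (intro sum_mono2) (auto simp: Z_def)
  also have "sum r {s\<in>J. r s > 0} = sum r J"
    using J(1) by (intro sum.mono_neutral_left) auto
  finally show False using Z(2) J(3) by simp
qed

text \<open>The flag: \<open>y\<^sub>e\<close> is the solution whose Taylor polynomial at \<open>a\<close> is \<open>(x + \<epsilon>)\<^sup>E/E!\<close> with
  \<open>E = m - 1 - e\<close>. The polynomials of the first \<open>l\<close> of these solutions are divisible by \<open>(x + \<epsilon>)\<^sup>m\<^sup>-\<^sup>l\<close>, and
  they are linearly independent since their degrees differ.\<close>
lemma disconjugate_imp_flag:
  assumes disc: "disconjugate a b m L"
    and L: "\<And>u t. t \<in> I \<Longrightarrow> L u t = dn m u t + (\<Sum>h<m. k h t * dn h u t)"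
    and k: "\<And>h. h < m \<Longrightarrow> continuous_on I (k h)"
  shows "\<exists>y. flag m y \<and> (\<forall>e<m. \<forall>t\<in>I. L (y e) t = 0)"
proof -
  have "\<forall>j. \<exists>u. u \<in> C m \<and> (\<forall>t\<in>I. L u t = 0) \<and> (\<forall>i<m. dn i u a = (if i = j then 1 else 0))"
  proof
    fix j
    have "\<exists>u\<in>C m. (\<forall>t\<in>I. dn m u t = - (\<Sum>h<m. k h t * dn h u t)) \<and>
        (\<forall>i<m. dn i u a = (if i = j then 1 else 0))"
      by (rule linear_ode_solution) (rule k)
    then obtain u where "u \<in> C m" "\<And>t. t \<in> I \<Longrightarrow> dn m u t = - (\<Sum>h<m. k h t * dn h u t)"
      "\<And>i. i < m \<Longrightarrow> dn i u a = (if i = j then 1 else 0)" by blast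
    then show "\<exists>u. u \<in> C m \<and> (\<forall>t\<in>I. L u t = 0) \<and> (\<forall>i<m. dn i u a = (if i = j then 1 else 0))"
      using L by (intro exI[of _ u]) auto
  qed
  then obtain \<phi> where \<phi>: "\<And>j. \<phi> j \<in> C m" "\<And>j t. t \<in> I \<Longrightarrow> L (\<phi> j) t = 0"
    "\<And>i j. i < m \<Longrightarrow> dn i (\<phi> j) a = (if i = j then 1 else 0)" by metis
  define Y where "Y d = (\<lambda>t. \<Sum>j<m. d j * \<phi> j t)" for d
  have YC: "Y d \<in> C m" for d unfolding Y_def using \<phi>(1) by (intro C_sum C_cmult)
  have dnY: "dn i (Y d) t = (\<Sum>j<m. d j * dn i (\<phi> j) t)" if "i \<le> m" "t \<in> I" for i d t
    unfolding Y_def by (rule dn_sum_cmult[OF \<phi>(1) that])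
  have Ya: "dn i (Y d) a = d i" if "i < m" for i d
    using dnY[of i a d] \<phi>(3)[OF that] sum_mult_indicator[OF that] that ab by simp
  have LY: "L (Y d) t = 0" if "t \<in> I" for d t
  proof -
    have "L (Y d) t = (\<Sum>j<m. d j * dn m (\<phi> j) t) + (\<Sum>h<m. \<Sum>j<m. k h t * (d j * dn h (\<phi> j) t))"
      using that by (simp add: L dnY sum_distrib_left)
    also have "(\<Sum>h<m. \<Sum>j<m. k h t * (d j * dn h (\<phi> j) t)) = (\<Sum>j<m. d j * (\<Sum>h<m. k h t * dn h (\<phi> j) t))"
      by (subst sum.swap) (simp add: sum_distrib_left mult.left_commute)
    also have "(\<Sum>j<m. d j * dn m (\<phi> j) t) + \<dots> = (\<Sum>j<m. d j * L (\<phi> j) t)"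
      using that by (simp add: L distrib_left sum.distrib)
    finally show ?thesis using \<phi>(2)[OF that] by simp
  qed
  have H: "d j = 0" if "t \<in> I" "a < t" "p + q = m" "\<And>i. i < p \<Longrightarrow> d i = 0"
    "\<And>i. i < q \<Longrightarrow> (\<Sum>j<m. d j * dn i (\<phi> j) t) = 0" "j < m" for d t j p q
  proof -
    have "Y d s = 0" if "s \<in> I" for s
    proof (rule disconjugate_zeros[OF disc YC LY, where J = "{a, t}" and r = "\<lambda>s. if s = a then p else q"])
      show "dn i (Y d) s = 0" if "s \<in> {a, t}" "i < (if s = a then p else q)" for s i
        using that Ya[of i d] dnY[of i t d] \<open>t \<in> I\<close> \<open>a < t\<close> \<open>p + q = m\<close> \<open>\<And>i. i < p \<Longrightarrow> d i = 0\<close>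
          \<open>\<And>i. i < q \<Longrightarrow> (\<Sum>j<m. d j * dn i (\<phi> j) t) = 0\<close> by (auto split: if_splits)
    qed (use that \<open>t \<in> I\<close> \<open>a < t\<close> \<open>p + q = m\<close> in auto)
    then have "dn j (Y d) a = dn j (\<lambda>t. 0) a" using ab by (intro dn_cong) auto
    also have "\<dots> = 0" using dn_sum_cmult[of "{}" \<phi> j j a] ab by simp
    finally show ?thesis using Ya[OF \<open>j < m\<close>] by simp
  qed
  have "\<forall>\<^sub>F \<epsilon> in at_right 0. \<forall>d. \<forall>t\<in>I.
    (\<forall>i<m - l. (\<Sum>j<m. d j * monom_deriv j i (- \<epsilon>)) = 0) \<longrightarrow>
    (\<forall>i<l. (\<Sum>j<m. d j * dn i (\<phi> j) t) = 0) \<longrightarrow> (\<forall>j<m. d j = 0)" if "l \<le> m" for l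
  proof -
    have ml: "m - l + l = m" using that by simp
    show ?thesis
    proof (rule perturbed_zero_at_left_end[OF \<phi>(1,3) ml])
      show "d j = 0" if "t \<in> I" "a < t" "\<And>i. i < m - l \<Longrightarrow> d i = 0"
        "\<And>i. i < l \<Longrightarrow> (\<Sum>j<m. d j * dn i (\<phi> j) t) = 0" "j < m" for d t j
        by (rule H[OF that(1,2) ml that(3-5)])
    qed
  qed
  then have "\<forall>\<^sub>F \<epsilon> in at_right 0. \<forall>l\<in>{..m}. \<forall>d. \<forall>t\<in>I.
    (\<forall>i<m - l. (\<Sum>j<m. d j * monom_deriv j i (- \<epsilon>)) = 0) \<longrightarrow>
    (\<forall>i<l. (\<Sum>j<m. d j * dn i (\<phi> j) t) = 0) \<longrightarrow> (\<forall>j<m. d j = 0)"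
    by (intro eventually_ball_finite) auto
  then obtain \<epsilon> where \<epsilon>: "\<forall>l\<in>{..m}. \<forall>d. \<forall>t\<in>I.
    (\<forall>i<m - l. (\<Sum>j<m. d j * monom_deriv j i (- \<epsilon>)) = 0) \<longrightarrow>
    (\<forall>i<l. (\<Sum>j<m. d j * dn i (\<phi> j) t) = 0) \<longrightarrow> (\<forall>j<m. d j = 0)"
    using eventually_happens'[OF trivial_limit_at_right_real] by blast
  define y where "y e = Y (\<lambda>j. monom_deriv (m - 1 - e) j \<epsilon>)" for e
  have "flag m y"
    unfolding flag_def
  proof (intro conjI allI impI ballI)
    fix l c t e
    assume l: "l \<le> m" and t: "t \<in> I" and 0: "\<forall>i<l. (\<Sum>e<l. c e * dn i (y e) t) = 0" and e: "e < l"
    define d where "d j = (\<Sum>e<l. c e * monom_deriv (m - 1 - e) j \<epsilon>)" for j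
    have swap: "(\<Sum>j<m. d j * f j) = (\<Sum>e<l. c e * (\<Sum>j<m. monom_deriv (m - 1 - e) j \<epsilon> * f j))" for f
      unfolding d_def sum_distrib_right sum_distrib_left by (subst sum.swap) (simp add: mult.assoc)
    have d0: "\<forall>j<m. d j = 0"
    proof -
      have "(\<Sum>j<m. d j * monom_deriv j i (- \<epsilon>)) = 0" if "i < m - l" for i
      proof -
        have "(\<Sum>j<m. monom_deriv (m - 1 - e) j \<epsilon> * monom_deriv j i (- \<epsilon>)) = 0" if "e < l" for e
          using monom_deriv_Taylor[of "m - 1 - e" m \<epsilon> i "- \<epsilon>"] that \<open>i < m - l\<close>
          by (simp add: monom_deriv_0)
        then show ?thesis unfolding swap by simp
      qed
      moreover have "(\<Sum>j<m. d j * dn i (\<phi> j) t) = 0" if "i < l" for i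
        unfolding swap using 0[rule_format, OF that] dnY[of i t] that l t by (simp add: y_def)
      ultimately show ?thesis using \<epsilon> l t by (meson atMost_iff)
    qed
    \<comment> \<open>The coefficients of the polynomial with initial values \<open>d\<close> vanish from the top degree down.\<close>
    show "c e = 0" using e
    proof (induction e rule: less_induct)
      case (less e)
      have "0 = d (m - 1 - e)" using d0 less.prems l by simp
      also have "\<dots> = (\<Sum>e'<l. if e' = e then c e else 0)"
        unfolding d_def using less l by (intro sum.cong) (auto simp: monom_deriv_def neq_iff)
      finally show ?case using less.prems by simp
    qed
  qed (simp add: y_def YC)
  then show ?thesis using LY by (intro exI[of _ y]) (auto simp: y_def)
qed

lemma disconjugate_imp_factorization:
  assumes k: "\<And>h. h \<le> m \<Longrightarrow> k h \<in> C (s + h)" "\<And>t. t \<in> I \<Longrightarrow> k m t = 1"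
    and L: "\<And>u t. L u t = (\<Sum>h\<le>m. k h t * dn h u t)" and disc: "disconjugate a b m L"
  shows "\<exists>w. (\<forall>l\<in>{1..m}. w l \<in> C (s + m) \<and> (\<forall>t\<in>I. w l t > 0)) \<and>
    (\<forall>u\<in>C m. \<forall>t\<in>I. L u t = (\<Prod>l=1..m. w l t) * Tseq a b w m u t)"
proof -
  have "\<exists>y. flag m y \<and> (\<forall>e<m. \<forall>t\<in>I. L (y e) t = 0)"
  proof (rule disconjugate_imp_flag[OF disc, of k])
    show "L u t = dn m u t + (\<Sum>h<m. k h t * dn h u t)" if "t \<in> I" for u t
      using k(2)[OF that] by (cases m) (simp_all add: L lessThan_Suc_atMost del: sum.lessThan_Suc)
    show "continuous_on I (k h)" if "h < m" for h
      using k(1)[of h] that C_continuous_on by auto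
  qed
  then obtain y where "flag m y" "\<And>e t. e < m \<Longrightarrow> t \<in> I \<Longrightarrow> L (y e) t = 0" by blast
  then show ?thesis
    unfolding L by (intro factorization_of_flag[OF k]) auto
qed

end

text \<open>The operator of order \<open>s + m\<close> is the one of order \<open>m\<close> applied to the \<open>s\<close>-th derivative; here it is
  indexed by the order of the derivative instead of the coefficient number.\<close>
lemma lin_diff_op_as_sum:
  assumes "N = s + m"
  shows "lin_diff_op a b N m p u t =
    (\<Sum>h\<le>m. (if h = m then 1 else p (m - h) t) * nderiv a b h (nderiv a b s u) t)"
proof -
  have "(\<Sum>h<m. p (m - h) t * nderiv a b (h + s) u t) = (\<Sum>j=1..m. p j t * nderiv a b (N - j) u t)"
    using assms by (intro sum.reindex_bij_witness[of _ "\<lambda>j. m - j" "\<lambda>h. m - h"]) (auto simp: add.commute)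
  moreover have "(\<Sum>h\<le>m. (if h = m then 1 else p (m - h) t) * nderiv a b (h + s) u t) =
      nderiv a b N u t + (\<Sum>h<m. p (m - h) t * nderiv a b (h + s) u t)"
    using assms by (simp add: lessThan_Suc_atMost[symmetric] add.commute)
  moreover have "nderiv a b h (nderiv a b s u) = nderiv a b (h + s) u" for h
    by (simp add: nderiv_def funpow_add)
  ultimately show ?thesis by (simp add: lin_diff_op_def)
qed

theorem proposition9p5:
  fixes a b :: real and n k m :: nat and S E :: "nat set" and \<alpha>\<^sub>2 \<beta>\<^sub>2 \<mu> :: int
    and p :: "nat \<Rightarrow> real \<Rightarrow> real"
  assumes "a < b" and "2 \<le> n" and "k \<in> {1..n - 1}"
    and "S \<subseteq> {0..n - 1}" and "card S = k"
    and "E \<subseteq> {0..n - 1}" and "card E = n - k"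
    and "last_gap S \<alpha>\<^sub>2" and "last_gap E \<beta>\<^sub>2"
    and "\<mu> = max \<alpha>\<^sub>2 \<beta>\<^sub>2" and "int m = int n - \<mu> - 1"
    and "\<And>j. j \<in> {1..m} \<Longrightarrow> p j \<in> Ck a b (n - j)"
    and "disconjugate a b m (lin_diff_op a b m m p)"
  shows "property_Td a b n S E (lin_diff_op a b n m p)"
proof -
  interpret proper_interval a b by unfold_locales (rule assms(1))
  have "-1 \<le> \<mu>" using assms(8,9,10) by (simp add: last_gap_def max_def)
  then have mn: "m \<le> n" using assms(11) by linarith
  define s where "s = n - m"
  have n: "n = s + m" and s: "int s = \<mu> + 1" using mn assms(11) by (auto simp: s_def)
  define q where "q h = (\<lambda>t. if h = m then 1 else p (m - h) t)" for h
  have op: "lin_diff_op a b N m p u t = (\<Sum>h\<le>m. q h t * dn h (dn s' u) t)" if "N = s' + m" for N s' u t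
    unfolding q_def by (rule lin_diff_op_as_sum[OF that])
  have "q h \<in> C (s + h)" if "h \<le> m" for h
    using assms(12)[of "m - h"] that n by (cases "h = m") (auto simp: q_def C_const)
  then obtain w where w: "\<And>l. l \<in> {1..m} \<Longrightarrow> w l \<in> C n" "\<And>l t. l \<in> {1..m} \<Longrightarrow> t \<in> I \<Longrightarrow> w l t > 0"
    "\<And>u t. u \<in> C m \<Longrightarrow> t \<in> I \<Longrightarrow>
      lin_diff_op a b m m p u t = (\<Prod>l=1..m. w l t) * Tseq a b w m u t"
    using disconjugate_imp_factorization[of m q s "lin_diff_op a b m m p"] op[of m 0] assms(13) n
    by (fastforce simp: q_def)
  define v where "v l = (if l \<le> s then (\<lambda>t. 1) else w (l - s))" for l
  have T1: "Tseq a b v l u = dn l u" if "l \<le> s" for l u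
    using that by (induction l) (simp_all add: v_def dn_Suc)
  have T2: "Tseq a b v (s + l) u = Tseq a b w l (dn s u)" for l u
    by (induction l) (simp_all add: T1, simp add: v_def)
  \<comment> \<open>The case \<open>j = i\<close> of the hypothesis serves \<open>i \<le> s\<close>, where \<open>T\<^sub>i u = u\<^sup>(\<^sup>i\<^sup>)\<close>; for \<open>i > s\<close> all orders from \<open>s\<close> to \<open>i\<close> matter.\<close>
  have T0: "Tseq a b v i u t = 0"
    if u: "u \<in> C n" and t: "t \<in> I" and i: "i < n" "\<And>j. j = i \<or> s \<le> j \<and> j \<le> i \<Longrightarrow> dn j u t = 0" for u t i
  proof (cases "i \<le> s")
    case True
    then show ?thesis using i by (simp add: T1)
  next
    case False
    have "Tseq a b w (i - s) (dn s u) t = 0"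
    proof (rule Tseq_zero[where k = m])
      show "w j \<in> C m" if "j \<in> {1..i - s}" for j
        using w(1)[of j] C_mono[of "w j" n m] that i(1) n by auto
      show "w j t > 0" if "j \<in> {1..i - s}" "t \<in> I" for j t
        using w(2)[of j t] that i(1) n by auto
      show "dn s u \<in> C m" using u n C_dn by simp
      show "dn j (dn s u) t = 0" if "j \<le> i - s" for j
        unfolding dn_dn using that False by (intro i(2)) auto
    qed (use i n t in auto)
    then show ?thesis using T2[of "i - s" u] False by simp
  qed
  have gap: "dn j u t = 0" if X: "X \<subseteq> {0..n - 1}" "last_gap X \<gamma>" "\<gamma> \<le> \<mu>" and i: "i \<in> X"
      and u: "\<And>i. i \<in> X \<Longrightarrow> dn i u t = 0" and j: "j = i \<or> s \<le> j \<and> j \<le> i" for X \<gamma> i j u t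
  proof -
    have "i \<le> Max X" using i X(1) finite_subset[OF X(1)] by simp
    moreover have "int j \<in> int ` X" if "s \<le> j" "j \<le> i"
    proof -
      have "int j \<in> {\<gamma> + 1..int (Max X)}" using that s X(3) \<open>i \<le> Max X\<close> by auto
      then show ?thesis using X(2) by (auto simp: last_gap_def)
    qed
    ultimately have "j \<in> X" using i j by (auto simp: inj_image_mem_iff)
    then show ?thesis by (rule u)
  qed
  show ?thesis
    unfolding property_Td_def
  proof (intro exI[of _ v] conjI ballI)
    show "v l \<in> C n" if "l \<in> {1..n}" for l
    proof (cases "l \<le> s")
      case False
      then have "l - s \<in> {1..m}" using that n by auto
      then show ?thesis using w(1) False by (simp add: v_def)
    qed (simp add: v_def C_const)
    show "v l t > 0" if "l \<in> {1..n}" "t \<in> I" for l t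
    proof (cases "l \<le> s")
      case False
      then have "l - s \<in> {1..m}" using that n by auto
      then show ?thesis using w(2) that(2) False by (simp add: v_def)
    qed (simp add: v_def)
    show "lin_diff_op a b n m p u t = (\<Prod>l = 1..n. v l t) * Tseq a b v n u t" if u: "u \<in> C n" and t: "t \<in> I" for u t
    proof -
      have "(\<Prod>l = 1..n. v l t) = (\<Prod>l = 1..m. w l t)"
      proof -
        have "(\<Prod>l = 1..n. v l t) = (\<Prod>l \<in> {s + 1..s + m}. v l t)"
          unfolding n by (intro prod.mono_neutral_right) (auto simp: v_def)
        also have "\<dots> = (\<Prod>l = 1..m. w l t)"
          by (intro prod.reindex_bij_witness[of _ "\<lambda>l. l + s" "\<lambda>l. l - s"]) (auto simp: v_def)
        finally show ?thesis .
      qed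
      moreover have "lin_diff_op a b n m p u t = lin_diff_op a b m m p (dn s u) t"
        using op[OF n] op[of m 0] by simp
      moreover have "dn s u \<in> C m" using u n C_dn by simp
      ultimately show ?thesis using w(3)[of "dn s u" t] t T2[of m u] n by simp
    qed
    fix u assume "u \<in> bvp_space a b n S E"
    then have u: "u \<in> C n" "\<And>i. i \<in> S \<Longrightarrow> dn i u a = 0" "\<And>i. i \<in> E \<Longrightarrow> dn i u b = 0"
      by (auto simp: bvp_space_def)
    show "Tseq a b v \<sigma> u a = 0" if "\<sigma> \<in> S" for \<sigma>
    proof (rule T0[OF u(1)])
      show "\<sigma> < n" using that assms(2,4) by force
      show "dn j u a = 0" if "j = \<sigma> \<or> s \<le> j \<and> j \<le> \<sigma>" for j
        by (rule gap[OF assms(4,8) _ \<open>\<sigma> \<in> S\<close> u(2) that]) (auto simp: assms(10))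
    qed (use ab in auto)
    show "Tseq a b v \<epsilon> u b = 0" if "\<epsilon> \<in> E" for \<epsilon>
    proof (rule T0[OF u(1)])
      show "\<epsilon> < n" using that assms(2,6) by force
      show "dn j u b = 0" if "j = \<epsilon> \<or> s \<le> j \<and> j \<le> \<epsilon>" for j
        by (rule gap[OF assms(6,9) _ \<open>\<epsilon> \<in> E\<close> u(3) that]) (auto simp: assms(10))
    qed (use ab in auto)
  qed
qed

end
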